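(* Let $\mathcal X\supseteq[0,1]^d$ and let the density $f_X$ of $X_i$ be such that $0<\inf_{x\in[0,1]^d}f_X(x)\le\sup_{x\in[0,1]^d}f_X(x)<\infty$. Let $B_K$ be the tensor product of $d$ univariate wavelet spaces $\mathrm{Wav}(K_0,[0,1])$ where $K=2^{dJ}$ and $K_0=2^J>2N$. Then $\|P_K\|_\infty\lesssim1$, i.e. there is a finite constant $C$ such that $\|P_K\|_\infty\le C$ for all sufficiently large $K$, where $P_K$ is the $L^2(X)$ orthogonal projection onto $B_K$.
   Context: $X_i$ takes values in $\mathcal X\subseteq\mathbb R^d$. $P_Kh(x)=b^K(x)'\big(E[b^K(X_i)b^K(X_i)']\big)^{-1}E[b^K(X_i)h(X_i)]$, where the elements of $b^K$ form a basis of $B_K$; $\|P_K\|_\infty=\sup\{\|P_Kh\|_\infty/\|h\|_\infty:h\in L^\infty(X),\|h\|_\infty\ne0\}$ with $\|h\|_\infty=\sup_{x\in\mathcal X}|h(x)|$ and $L^\infty(X)$ the bounded functions on $\mathcal X$. Wavelet space: let $(\varphi,\psi)$ be a Daubechies pair with $\varphi$ (continuous and) supported on $[-N+1,N]$, $N$ fixed. For $2^J>2N$, $\mathrm{Wav}(K_0,[0,1])$, $K_0=2^J$, is the span $V_J$ of the Cohen–Daubechies–Vial (1993) boundary-corrected scaling functions, which are orthonormal in $L^2([0,1])$ (Lebesgue measure): interior functions $2^{J/2}\varphi(2^Jx-k)$, $k=N,\ldots,2^J-N-1$; left functions $2^{J/2}\varphi^l_k(2^Jx)$, $k=0,\ldots,N-1$,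 supported on $[0,2^{-J}(N+k)]$; right functions $2^{J/2}\varphi^r_{-k}(2^J(x-1))$, $k=1,\ldots,N$; here $\varphi^l_k,\varphi^r_{-k}$ are fixed continuous compactly supported functions independent of $J$. The tensor-product basis $b^K$ consists of all $K=2^{dJ}$ products $\prod_{l=1}^d\varphi_{J,k_l}(x_l)$ of univariate basis functions, $x\in[0,1]^d$, and is zero outside $[0,1]^d$. *)

theory Defs
  imports "HOL-Probability.Probability"
begin

section \<open>Daubechies pairs\<close>

text \<open>The orthonormal Daubechies family with \<open>N\<close> vanishing moments, translated so that the support
  of \<open>\<phi>\<close> is \<open>[-N+1, N]\<close>.  The sequence \<open>h\<close> is the low-pass filter, with \<open>2 * N\<close> taps.\<close>

definition daubechies_pair :: "nat \<Rightarrow> (real \<Rightarrow> real) \<Rightarrow> (real \<Rightarrow> real) \<Rightarrow> bool" where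
  "daubechies_pair N \<phi> \<psi> \<longleftrightarrow>
     closure {x. \<phi> x \<noteq> 0} = {- real N + 1 .. real N} \<and>
     (LINT x|lborel. \<phi> x) = 1 \<and>
     (\<forall>m::int. (LINT x|lborel. \<phi> x * \<phi> (x - of_int m)) = (if m = 0 then 1 else 0)) \<and>
     (\<exists>h :: int \<Rightarrow> real.
        (\<forall>x. \<phi> x = sqrt 2 * (\<Sum>k = 1 - int N..int N. h k * \<phi> (2 * x - of_int k))) \<and>
        (\<forall>x. \<psi> x = sqrt 2 * (\<Sum>k = 1 - int N..int N.
                (-1) powi k * h (1 - k) * \<phi> (2 * x - of_int k)))) \<and>
     (\<forall>p<N. (LINT x|lborel. x ^ p * \<psi> x) = 0)"


section \<open>Cohen--Daubechies--Vial boundary-corrected scaling functions\<close>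

definition half_line_inner :: "(real \<Rightarrow> real) \<Rightarrow> (real \<Rightarrow> real) \<Rightarrow> real" where
  "half_line_inner f g = (LINT x:{0..}|lborel. f x * g x)"

text \<open>The edge functions of Cohen, Daubechies and Vial on the half line before orthonormalisation.
  Together with \<open>\<phi>(x - m)\<close>, \<open>m \<ge> N\<close>, they reproduce the polynomials of degree below \<open>N\<close> on
  \<open>[0, \<infinity>)\<close>; the \<open>k\<close>-th one is supported on \<open>[0, 2N - 1 - k]\<close>.\<close>

definition cdv_edge :: "nat \<Rightarrow> (real \<Rightarrow> real) \<Rightarrow> nat \<Rightarrow> real \<Rightarrow> real" where
  "cdv_edge N \<phi> k x =
     (if 0 \<le> x then \<Sum>n = k..2 * N - 2. real (n choose k) * \<phi> (x + real n - real N + 1) else 0)"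

text \<open>Gram--Schmidt in \<open>L\<^sup>2([0, \<infinity>))\<close>, starting from the edge function of smallest support
  (index \<open>N - 1\<close>) and going down, so that \<open>cdv_left N \<phi> k\<close> is supported on \<open>[0, N + k]\<close>.
  Only the indices \<open>k < N\<close> are meaningful.\<close>

fun cdv_left :: "nat \<Rightarrow> (real \<Rightarrow> real) \<Rightarrow> nat \<Rightarrow> real \<Rightarrow> real" where
  "cdv_left N \<phi> k =
     (let e = cdv_edge N \<phi> (N - 1 - k);
          u = (\<lambda>x. e x - (\<Sum>j<k. half_line_inner e (cdv_left N \<phi> j) * cdv_left N \<phi> j x))
      in (\<lambda>x. u x / sqrt (half_line_inner u u)))"

declare cdv_left.simps [simp del]

text \<open>\<open>cdv_right N \<phi> k\<close>, for \<open>1 \<le> k \<le> N\<close>, is the right edge function with index \<open>-k\<close>, living on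
  \<open>(-\<infinity>, 0]\<close>.  It is the mirror image of the left construction; \<open>\<lambda>y. \<phi> (1 - y)\<close> is the
  Daubechies scaling function of the reversed filter and is again supported on \<open>[-N+1, N]\<close>.\<close>

definition cdv_right :: "nat \<Rightarrow> (real \<Rightarrow> real) \<Rightarrow> nat \<Rightarrow> real \<Rightarrow> real" where
  "cdv_right N \<phi> k x = cdv_left N (\<lambda>y. \<phi> (1 - y)) (k - 1) (- x)"

text \<open>The orthonormal basis of \<open>Wav(2^J, [0,1])\<close> for \<open>2 ^ J > 2 * N\<close>, indexed by \<open>k < 2 ^ J\<close>: left
  functions for \<open>k < N\<close>, interior ones for \<open>N \<le> k < 2 ^ J - N\<close>, and for the last \<open>N\<close> indices the
  right functions with index \<open>k - 2 ^ J\<close> in \<open>{-N..-1}\<close>.\<close>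

definition cdv_scaling :: "nat \<Rightarrow> (real \<Rightarrow> real) \<Rightarrow> nat \<Rightarrow> nat \<Rightarrow> real \<Rightarrow> real" where
  "cdv_scaling N \<phi> J k x =
     (if x \<in> {0..1} then
        2 powr (real J / 2) *
          (if k < N then cdv_left N \<phi> k (2 ^ J * x)
           else if k < 2 ^ J - N then \<phi> (2 ^ J * x - real k)
           else cdv_right N \<phi> (2 ^ J - k) (2 ^ J * (x - 1)))
      else 0)"

definition wav_index :: "nat \<Rightarrow> ('d::finite \<Rightarrow> nat) set" where
  "wav_index J = {k. \<forall>l. k l < 2 ^ J}"

definition wav_tensor :: "nat \<Rightarrow> (real \<Rightarrow> real) \<Rightarrow> nat \<Rightarrow> ('d::finite \<Rightarrow> nat) \<Rightarrow> real ^ 'd \<Rightarrow> real" where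
  "wav_tensor N \<phi> J k x = (\<Prod>l\<in>UNIV. cdv_scaling N \<phi> J (k l) (x $ l))"


section \<open>The series projection and its sup-norm operator norm\<close>

definition gram :: "'w measure \<Rightarrow> ('w \<Rightarrow> 'x) \<Rightarrow> ('k \<Rightarrow> 'x \<Rightarrow> real) \<Rightarrow> 'k \<Rightarrow> 'k \<Rightarrow> real" where
  "gram M X b i j = (LINT \<omega>|M. b i (X \<omega>) * b j (X \<omega>))"

text \<open>The inverse of a matrix with rows and columns indexed by the finite set \<open>I\<close>; the analogue of
  \<open>matrix_inv\<close> for an index set that is not a type.\<close>

definition matrix_inv_on :: "'k set \<Rightarrow> ('k \<Rightarrow> 'k \<Rightarrow> real) \<Rightarrow> 'k \<Rightarrow> 'k \<Rightarrow> real" where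
  "matrix_inv_on I A = (SOME B. \<forall>i\<in>I. \<forall>j\<in>I.
     (\<Sum>k\<in>I. A i k * B k j) = (if i = j then 1 else 0) \<and>
     (\<Sum>k\<in>I. B i k * A k j) = (if i = j then 1 else 0))"

definition series_proj ::
  "'w measure \<Rightarrow> ('w \<Rightarrow> 'x) \<Rightarrow> 'k set \<Rightarrow> ('k \<Rightarrow> 'x \<Rightarrow> real) \<Rightarrow> ('x \<Rightarrow> real) \<Rightarrow> 'x \<Rightarrow> real" where
  "series_proj M X I b h x =
     (\<Sum>i\<in>I. \<Sum>j\<in>I. b i x * matrix_inv_on I (gram M X b) i j * (LINT \<omega>|M. b j (X \<omega>) * h (X \<omega>)))"

definition sup_norm :: "'x set \<Rightarrow> ('x \<Rightarrow> real) \<Rightarrow> ennreal" where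
  "sup_norm S h = (SUP x\<in>S. ennreal \<bar>h x\<bar>)"

text \<open>The bounded functions on \<open>S\<close>, represented by total functions whose values outside \<open>S\<close> play no
  role, as \<open>X\<close> takes values in \<open>S\<close>.  Measurability of \<open>h(X)\<close> is what gives the expectations in
  \<open>series_proj\<close> their meaning.\<close>

definition bounded_functions :: "'w measure \<Rightarrow> ('w \<Rightarrow> 'x) \<Rightarrow> 'x set \<Rightarrow> ('x \<Rightarrow> real) set" where
  "bounded_functions M X S = {h. bounded (h ` S) \<and> (\<lambda>\<omega>. h (X \<omega>)) \<in> borel_measurable M}"

definition proj_norm ::
  "'w measure \<Rightarrow> ('w \<Rightarrow> 'x) \<Rightarrow> 'x set \<Rightarrow> 'k set \<Rightarrow> ('k \<Rightarrow> 'x \<Rightarrow> real) \<Rightarrow> ennreal" where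
  "proj_norm M X S I b =
     (SUP h\<in>{h \<in> bounded_functions M X S. sup_norm S h \<noteq> 0}.
        sup_norm S (series_proj M X I b h) / sup_norm S h)"

end

theory Submission
  imports Defs
begin

text \<open>
  Write \<open>b\<close> for the tensor basis, \<open>G\<close> for its Gram matrix under the law of \<open>X\<close> and \<open>d\<close> for the
  dimension.  At a point \<open>x\<close> the projection of \<open>h\<close> is the sum of \<open>b i x * a i\<close>, where \<open>a\<close> solves
  \<open>G a = y\<close> and \<open>y j\<close> is the expectation of \<open>b j (X) * h (X)\<close>.  The basis functions have size
  \<open>2 ^ (d J / 2)\<close>, overlap a bounded number of times, and live on cubes of volume \<open>2 ^ (- d J)\<close>.  Hence
  \<open>|y j|\<close> is at most a constant times \<open>2 ^ (- d J / 2)\<close> times the sup norm of \<open>h\<close>, and the sum of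
  \<open>|b i x|\<close> over \<open>i\<close> is at most a constant times \<open>2 ^ (d J / 2)\<close>.  The powers of 2 cancel, and it
  remains to bound the inverse of \<open>G\<close> on \<open>\<ell>\<^sup>\<infinity>\<close> uniformly in \<open>J\<close>.

  The basis is orthonormal in \<open>L\<^sup>2\<close> of Lebesgue measure on the unit cube, so the bounds on the density
  of \<open>X\<close> make \<open>G\<close> coercive and its entries bounded, uniformly in \<open>J\<close>.  Moreover \<open>G i j = 0\<close> as soon
  as \<open>i\<close> and \<open>j\<close> differ by more than \<open>2 * N\<close> in some coordinate.  Such a matrix has an inverse whose
  entries decay exponentially off the diagonal (Demko, Moss and Smith).  The consequence that is used,
  stability in the sup norm, is proved here by an energy estimate with exponential weights
  (\<open>banded_coercive_sup_bound\<close>).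

  Orthonormality of the univariate basis has to be extracted from the Gram--Schmidt construction at
  the edges.  The point is that the edge functions are linearly independent, which holds because their
  supports end at different integers and \<open>\<phi>\<close> is nonzero arbitrarily close to the ends of its support
  (\<open>residual_norm_pos\<close>), and that left and right edge functions do not interact once \<open>2 ^ J\<close> is at
  least \<open>4 * N\<close> (\<open>line_basis_orthonormal\<close>).
\<close>

section \<open>Positive definite matrices over a finite index set\<close>

text \<open>Block elimination: with the unknown at the new index \<open>p\<close> eliminated, the remaining unknowns solve
  a system with the Schur complement of \<open>A p p\<close>.  The Schur complement is again positive definite,
  because its quadratic form at \<open>v\<close> is the quadratic form of \<open>A\<close> at the extension of \<open>v\<close> to \<open>p\<close>
  that minimises it, namely by \<open>- s / A p p\<close> below.\<close>

lemma posdef_system_solvable: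
  fixes A :: "'k \<Rightarrow> 'k \<Rightarrow> real"
  assumes "finite I"
    and "\<And>i j. i \<in> I \<Longrightarrow> j \<in> I \<Longrightarrow> A i j = A j i"
    and "\<And>v. \<exists>i\<in>I. v i \<noteq> 0 \<Longrightarrow> 0 < (\<Sum>i\<in>I. \<Sum>j\<in>I. v i * A i j * v j)"
  shows "\<exists>a. \<forall>i\<in>I. (\<Sum>j\<in>I. A i j * a j) = y i"
  using assms
proof (induction I arbitrary: A y rule: finite_induct)
  case empty
  then show ?case by simp
next
  case (insert p I)
  note [simp] = insert.hyps
  have sym: "A i p = A p i" if "i \<in> I" for i using insert.prems(1) that by simp
  have pp: "0 < A p p"
  proof -
    have "0 < (\<Sum>i\<in>insert p I. \<Sum>j\<in>insert p I. of_bool (i = p) * A i j * of_bool (j = p))"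
      by (rule insert.prems(2)) auto
    also have "\<dots> = A p p"
    proof -
      have "(\<Sum>j\<in>I. A p j * of_bool (j = p)) = 0" "(\<Sum>i\<in>I. of_bool (i = p) * A i p) = 0"
        using insert.hyps by (auto intro!: sum.neutral)
      moreover have "(\<Sum>i\<in>I. \<Sum>j\<in>I. of_bool (i = p) * A i j * of_bool (j = p)) = 0"
        by (intro sum.neutral ballI) (use insert.hyps in auto)
      ultimately show ?thesis
        by (simp only: sum.insert[OF insert.hyps] sum.distrib) simp
    qed
    finally show ?thesis .
  qed
  define A' where "A' i j = A i j - A i p * A p j / A p p" for i j
  have "\<exists>a. \<forall>i\<in>I. (\<Sum>j\<in>I. A' i j * a j) = y i - A i p * y p / A p p"
  proof (rule insert.IH)
    show "A' i j = A' j i" if "i \<in> I" "j \<in> I" for i j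
      using that insert.prems(1) by (simp add: A'_def)
  next
    fix v :: "'k \<Rightarrow> real"
    assume v: "\<exists>i\<in>I. v i \<noteq> 0"
    define s where "s = (\<Sum>j\<in>I. A p j * v j)"
    define v' where "v' = v(p := - s / A p p)"
    have v'I: "v' i = v i" if "i \<in> I" for i using that insert.hyps by (auto simp: v'_def)
    have v'p: "v' p = - s / A p p" by (simp add: v'_def)
    have "\<exists>i\<in>insert p I. v' i \<noteq> 0" using v v'I by force
    then have "0 < (\<Sum>i\<in>insert p I. \<Sum>j\<in>insert p I. v' i * A i j * v' j)"
      by (rule insert.prems(2))
    also have "\<dots> = v' p * A p p * v' p + (\<Sum>j\<in>I. v' p * A p j * v' j)
        + (\<Sum>i\<in>I. v' i * A i p * v' p + (\<Sum>j\<in>I. v' i * A i j * v' j))"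
      by simp
    also have "(\<Sum>j\<in>I. v' p * A p j * v' j) = v' p * s"
      by (simp add: s_def v'I sum_distrib_left mult_ac cong: sum.cong)
    also have "(\<Sum>i\<in>I. v' i * A i p * v' p + (\<Sum>j\<in>I. v' i * A i j * v' j))
        = v' p * s + (\<Sum>i\<in>I. \<Sum>j\<in>I. v i * A i j * v j)"
      by (simp add: s_def v'I sum.distrib sum_distrib_left sym mult_ac cong: sum.cong)
    also have "v' p * A p p * v' p + v' p * s + (v' p * s + (\<Sum>i\<in>I. \<Sum>j\<in>I. v i * A i j * v j))
        = (\<Sum>i\<in>I. \<Sum>j\<in>I. v i * A i j * v j) - s * s / A p p"
      using pp by (simp add: v'p field_simps)
    also have "s * s = (\<Sum>i\<in>I. \<Sum>j\<in>I. (A p i * v i) * (A p j * v j))"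
      by (simp add: s_def sum_product)
    also have "(\<Sum>i\<in>I. \<Sum>j\<in>I. v i * A i j * v j) - (\<Sum>i\<in>I. \<Sum>j\<in>I. (A p i * v i) * (A p j * v j)) / A p p
        = (\<Sum>i\<in>I. \<Sum>j\<in>I. v i * A' i j * v j)"
      by (simp add: A'_def sum_divide_distrib sum_subtractf [symmetric] sym algebra_simps
            cong: sum.cong)
    finally show "0 < (\<Sum>i\<in>I. \<Sum>j\<in>I. v i * A' i j * v j)" .
  qed
  then obtain a where a: "\<And>i. i \<in> I \<Longrightarrow> (\<Sum>j\<in>I. A' i j * a j) = y i - A i p * y p / A p p"
    by blast
  define s where "s = (\<Sum>j\<in>I. A p j * a j)"
  define a' where "a' = a(p := (y p - s) / A p p)"
  have a'I: "a' i = a i" if "i \<in> I" for i using that insert.hyps by (auto simp: a'_def)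
  have sums: "(\<Sum>j\<in>insert p I. A i j * a' j) = A i p * (y p - s) / A p p + (\<Sum>j\<in>I. A i j * a j)" for i
    by (simp add: a'I cong: sum.cong) (simp add: a'_def)
  have "(\<Sum>j\<in>insert p I. A i j * a' j) = y i" if "i \<in> insert p I" for i
  proof (cases "i = p")
    case True
    then show ?thesis using pp by (simp add: sums s_def)
  next
    case False
    then have "i \<in> I" using that by simp
    have "(\<Sum>j\<in>I. A' i j * a j) = (\<Sum>j\<in>I. A i j * a j) - A i p * s / A p p"
      by (simp add: A'_def s_def algebra_simps sum_subtractf sum_distrib_left sum_divide_distrib)
    with a[OF \<open>i \<in> I\<close>] show ?thesis
      by (simp add: sums right_diff_distrib diff_divide_distrib)
  qed
  then show ?case by blast
qed

text \<open>The choice operator in \<^const>\<open>matrix_inv_on\<close> asks for a two-sided inverse.  Solving for the unit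
  vectors gives a right inverse, and symmetry turns it into a left inverse as well.\<close>

lemma matrix_inv_on_right_inverse:
  fixes A :: "'k \<Rightarrow> 'k \<Rightarrow> real"
  assumes "finite I"
    and sym: "\<And>i j. i \<in> I \<Longrightarrow> j \<in> I \<Longrightarrow> A i j = A j i"
    and pos: "\<And>v. \<exists>i\<in>I. v i \<noteq> 0 \<Longrightarrow> 0 < (\<Sum>i\<in>I. \<Sum>j\<in>I. v i * A i j * v j)"
    and "i \<in> I" "j \<in> I"
  shows "(\<Sum>k\<in>I. A i k * matrix_inv_on I A k j) = (if i = j then 1 else 0)"
proof -
  have "\<exists>a. \<forall>i\<in>I. (\<Sum>k\<in>I. A i k * a k) = (if i = j then 1 else 0)" for j
    by (rule posdef_system_solvable) (fact \<open>finite I\<close>, fact sym, fact pos)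
  then obtain R where R: "\<And>i j. i \<in> I \<Longrightarrow> (\<Sum>k\<in>I. A i k * R j k) = (if i = j then 1 else 0)"
    by metis
  \<comment> \<open>\<open>R\<close> is indexed by columns first.  It is symmetric because \<open>R j i\<close> and \<open>R i j\<close> are both the
    double sum over \<open>k\<close> and \<open>l\<close> of \<open>R j k * A k l * R i l\<close>.\<close>
  have R_sym: "R j i = R i j" if "i \<in> I" "j \<in> I" for i j
  proof -
    have "R j i = (\<Sum>k\<in>I. R j k * (\<Sum>l\<in>I. A k l * R i l))"
      using that assms(1) by (simp add: R if_distrib[of "(*) _"] cong: if_cong)
    also have "\<dots> = (\<Sum>l\<in>I. R i l * (\<Sum>k\<in>I. A l k * R j k))"
      unfolding sum_distrib_left
      by (subst sum.swap) (intro sum.cong refl, simp add: sym mult_ac)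
    also have "\<dots> = R i j"
      using that assms(1) by (simp add: R if_distrib[of "(*) _"] cong: if_cong)
    finally show ?thesis .
  qed
  have "\<exists>B. \<forall>i\<in>I. \<forall>j\<in>I. (\<Sum>k\<in>I. A i k * B k j) = (if i = j then 1 else 0) \<and>
     (\<Sum>k\<in>I. B i k * A k j) = (if i = j then 1 else 0)"
  proof (intro exI[of _ "\<lambda>i j. R j i"] ballI conjI)
    fix i j assume ij: "i \<in> I" "j \<in> I"
    show "(\<Sum>k\<in>I. A i k * R j k) = (if i = j then 1 else 0)" by (rule R[OF ij(1)])
    have "(\<Sum>k\<in>I. R k i * A k j) = (\<Sum>k\<in>I. A j k * R i k)"
      using ij by (intro sum.cong) (auto simp: R_sym sym)
    then show "(\<Sum>k\<in>I. R k i * A k j) = (if i = j then 1 else 0)"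
      by (simp add: R ij eq_commute)
  qed
  from someI_ex[OF this] show ?thesis
    using assms(4,5) unfolding matrix_inv_on_def by blast
qed

section \<open>Sup-norm stability of banded coercive systems\<close>

lemma sum_power_dist_le:
  fixes q :: real
  assumes "0 \<le> q" "q < 1"
  shows "(\<Sum>t<n. q ^ nat \<bar>int t - int s\<bar>) \<le> 2 / (1 - q)"
proof -
  have geo: "(\<Sum>t\<in>T. q ^ e t) \<le> 1 / (1 - q)" if "finite T" "inj_on e T" for e and T :: "nat set"
  proof -
    have "(\<Sum>t\<in>T. q ^ e t) = (\<Sum>u\<in>e ` T. q ^ u)"
      using that by (simp add: sum.reindex)
    also have "\<dots> \<le> (\<Sum>u. q ^ u)"
      using that assms by (intro sum_le_suminf) auto
    finally show ?thesis using assms by (simp add: suminf_geometric)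
  qed
  have "(\<Sum>t<n. q ^ nat \<bar>int t - int s\<bar>)
      = (\<Sum>t\<in>{..<n} \<inter> {..<s}. q ^ nat \<bar>int t - int s\<bar>) + (\<Sum>t\<in>{..<n} - {..<s}. q ^ nat \<bar>int t - int s\<bar>)"
    by (rule sum.Int_Diff) simp
  also have "\<dots> \<le> 1 / (1 - q) + 1 / (1 - q)"
    by (intro add_mono geo) (auto simp: inj_on_def)
  finally show ?thesis by simp
qed

text \<open>The \<open>\<ell>\<^sup>1\<close> distance is used because a power of it is a product over the coordinates, so that
  sums of such powers factorise.\<close>

definition grid_dist :: "('d::finite \<Rightarrow> nat) \<Rightarrow> ('d \<Rightarrow> nat) \<Rightarrow> nat" where
  "grid_dist i j = (\<Sum>l\<in>UNIV. nat \<bar>int (i l) - int (j l)\<bar>)"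

lemma grid_dist_triangle: "grid_dist i k \<le> grid_dist i j + grid_dist j k"
  unfolding grid_dist_def sum.distrib[symmetric] by (rule sum_mono) linarith

lemma grid_ball_bound:
  fixes i :: "'d::finite \<Rightarrow> nat"
  assumes "finite I"
  shows "real (card {j \<in> I. \<forall>l. \<bar>int (i l) - int (j l)\<bar> \<le> int m}) \<le> real (2 * m + 1) ^ CARD('d)"
proof -
  have "{j \<in> I. \<forall>l. \<bar>int (i l) - int (j l)\<bar> \<le> int m} \<subseteq> PiE UNIV (\<lambda>l. {i l - m..i l + m})"
  proof
    fix j assume "j \<in> {j \<in> I. \<forall>l. \<bar>int (i l) - int (j l)\<bar> \<le> int m}"
    then have near: "\<bar>int (i l) - int (j l)\<bar> \<le> int m" for l by blast
    have "i l - m \<le> j l \<and> j l \<le> i l + m" for l using near[of l] by linarith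
    then show "j \<in> PiE UNIV (\<lambda>l. {i l - m..i l + m})" by auto
  qed
  then have "card {j \<in> I. \<forall>l. \<bar>int (i l) - int (j l)\<bar> \<le> int m} \<le> card (PiE UNIV (\<lambda>l. {i l - m..i l + m}))"
    by (intro card_mono finite_PiE) auto
  also have "\<dots> = (\<Prod>l\<in>(UNIV::'d set). card {i l - m..i l + m})"
    by (simp add: card_PiE)
  also have "\<dots> \<le> (\<Prod>l\<in>(UNIV::'d set). 2 * m + 1)"
    by (intro prod_mono) auto
  finally have "card {j \<in> I. \<forall>l. \<bar>int (i l) - int (j l)\<bar> \<le> int m} \<le> (2 * m + 1) ^ CARD('d)"
    by simp
  then show ?thesis unfolding of_nat_power[symmetric] by (rule of_nat_mono)
qed

lemma sum_grid_product:
  fixes g :: "'d::finite \<Rightarrow> nat \<Rightarrow> real"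
  shows "(\<Sum>k\<in>{k. \<forall>l. k l < n}. \<Prod>l\<in>UNIV. g l (k l)) = (\<Prod>l\<in>UNIV. \<Sum>t<n. g l t)"
proof -
  have "{k :: 'd \<Rightarrow> nat. \<forall>l. k l < n} = PiE UNIV (\<lambda>_. {..<n})" by auto
  then show ?thesis by (simp add: prod_sum_PiE)
qed

lemma sum_power_grid_dist_le:
  fixes i0 :: "'d::finite \<Rightarrow> nat" and q :: real
  assumes "0 \<le> q" "q < 1" "finite I"
  shows "(\<Sum>i\<in>I. q ^ grid_dist i i0) \<le> (2 / (1 - q)) ^ CARD('d)"
proof -
  define n where "n = Suc (Max (insert 0 (\<Union>i\<in>I. range i)))"
  have I_sub: "I \<subseteq> {k. \<forall>l. k l < n}"
    using \<open>finite I\<close> by (auto simp: n_def less_Suc_eq_le intro!: Max_ge)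
  have fin: "finite {k :: 'd \<Rightarrow> nat. \<forall>l. k l < n}"
    using finite_PiE[of "UNIV :: 'd set" "\<lambda>_. {..<n}"] by (simp add: PiE_UNIV_domain Pi_def)
  have "(\<Sum>i\<in>I. q ^ grid_dist i i0) \<le> (\<Sum>i\<in>{k. \<forall>l. k l < n}. q ^ grid_dist i i0)"
    using I_sub fin assms by (intro sum_mono2) auto
  also have "\<dots> = (\<Prod>l\<in>(UNIV::'d set). \<Sum>t<n. q ^ nat \<bar>int t - int (i0 l)\<bar>)"
    unfolding grid_dist_def power_sum
    by (rule sum_grid_product[where g = "\<lambda>l t. q ^ nat \<bar>int t - int (i0 l)\<bar>" and n = n])
  also have "\<dots> \<le> (\<Prod>l\<in>(UNIV::'d set). 2 / (1 - q))"
    using assms by (intro prod_mono conjI sum_nonneg sum_power_dist_le) auto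
  finally show ?thesis by simp
qed

text \<open>A coercive matrix on the grid with bounded entries and bounded band width has an inverse that is
  bounded on \<open>\<ell>\<^sup>\<infinity>\<close>, with a constant that depends neither on the size of the index set nor on the
  matrix.  Coercivity alone controls only \<open>\<ell>\<^sup>2\<close> norms.  To bound the single entry \<open>a i0\<close>, the energy
  estimate is applied to \<open>v = w * a\<close> with the weight \<open>w i = \<rho> ^ grid_dist i i0\<close>, which is 1 at
  \<open>i0\<close> and square summable uniformly in the index set.  Multiplying by \<open>w\<close> does not commute with
  \<open>A\<close>, but because \<open>A\<close> is banded the commutator \<open>R\<close> only sees ratios of weights at neighbouring
  indices.  For \<open>\<rho>\<close> close to 1 these are close to 1, and the commutator is absorbed by coercivity.\<close>

lemma banded_coercive_sup_bound:
  fixes \<alpha> \<Gamma> :: real and m :: nat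
  assumes "0 < \<alpha>" "0 \<le> \<Gamma>"
  obtains C where "0 \<le> C"
    and "\<And>I (A :: ('d::finite \<Rightarrow> nat) \<Rightarrow> ('d \<Rightarrow> nat) \<Rightarrow> real) a Y i.
      \<lbrakk>finite I; \<And>i j. \<lbrakk>i \<in> I; j \<in> I\<rbrakk> \<Longrightarrow> \<bar>A i j\<bar> \<le> \<Gamma>;
       \<And>i j l. \<lbrakk>i \<in> I; j \<in> I; int m < \<bar>int (i l) - int (j l)\<bar>\<rbrakk> \<Longrightarrow> A i j = 0;
       \<And>v. \<alpha> * (\<Sum>i\<in>I. (v i)\<^sup>2) \<le> (\<Sum>i\<in>I. \<Sum>j\<in>I. v i * A i j * v j);
       \<And>i. i \<in> I \<Longrightarrow> \<bar>\<Sum>j\<in>I. A i j * a j\<bar> \<le> Y; 0 \<le> Y; i \<in> I\<rbrakk>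
      \<Longrightarrow> \<bar>a i\<bar> \<le> C * Y"
proof -
  define B where "B = real (2 * m + 1) ^ CARD('d)"
  define D where "D = CARD('d) * m"
  define \<epsilon> where "\<epsilon> = \<alpha> / (2 * (\<Gamma> * B + 1))"
  define t where "t = \<epsilon> / ((1 + \<epsilon>) * (real D + 1))"
  define \<rho> where "\<rho> = 1 - t"
  define W where "W = (2 / (1 - \<rho>\<^sup>2)) ^ CARD('d)"
  have B: "0 \<le> B" by (simp add: B_def)
  have \<Gamma>B: "0 \<le> \<Gamma> * B" using assms B by simp
  have \<epsilon>: "0 < \<epsilon>" using assms \<Gamma>B by (simp add: \<epsilon>_def)
  have \<epsilon>2: "\<epsilon> * (\<Gamma> * B) \<le> \<alpha> / 2"
    using assms \<Gamma>B by (simp add: \<epsilon>_def field_simps)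
  have t: "0 < t" "t < 1"
  proof -
    show "0 < t" using \<epsilon> by (simp add: t_def)
    have "\<epsilon> < (1 + \<epsilon>) * 1" by simp
    also have "\<dots> \<le> (1 + \<epsilon>) * (real D + 1)" using \<epsilon> by (intro mult_left_mono) auto
    finally show "t < 1" using \<epsilon> by (simp add: t_def)
  qed
  have \<rho>: "0 < \<rho>" "\<rho> < 1" using t by (auto simp: \<rho>_def)
  have \<rho>2: "0 \<le> \<rho>\<^sup>2" "\<rho>\<^sup>2 < 1" using \<rho> by (auto simp: power_less_one_iff)
  have W: "0 \<le> W" using \<rho>2 by (simp add: W_def)
  \<comment> \<open>Bernoulli's inequality gives a base \<open>\<rho>\<close> so close to 1 that the weights change by a factor of
    at most \<open>1 + \<epsilon>\<close> across the band.\<close>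
  have \<rho>D: "1 \<le> (1 + \<epsilon>) * \<rho> ^ D"
  proof -
    have "real D * t \<le> (real D + 1) * t" using t by (simp add: algebra_simps)
    also have "\<dots> = \<epsilon> / (1 + \<epsilon>)" using \<epsilon> by (simp add: t_def)
    finally have "1 / (1 + \<epsilon>) \<le> 1 - real D * t" using \<epsilon> by (simp add: field_simps)
    also have "\<dots> \<le> \<rho> ^ D"
      using Bernoulli_inequality[of "- t" D] t by (simp add: \<rho>_def)
    finally show ?thesis using \<epsilon> by (simp add: field_simps)
  qed
  define C where "C = 2 * sqrt W / \<alpha>"
  have C: "0 \<le> C" using W assms by (simp add: C_def)
  show thesis
  proof (rule that[OF C])
    fix I and A :: "('d \<Rightarrow> nat) \<Rightarrow> ('d \<Rightarrow> nat) \<Rightarrow> real" and a Y i0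
    assume fin: "finite I" and bd: "\<And>i j. \<lbrakk>i \<in> I; j \<in> I\<rbrakk> \<Longrightarrow> \<bar>A i j\<bar> \<le> \<Gamma>"
      and band: "\<And>i j l. \<lbrakk>i \<in> I; j \<in> I; int m < \<bar>int (i l) - int (j l)\<bar>\<rbrakk> \<Longrightarrow> A i j = 0"
      and coer: "\<And>v. \<alpha> * (\<Sum>i\<in>I. (v i)\<^sup>2) \<le> (\<Sum>i\<in>I. \<Sum>j\<in>I. v i * A i j * v j)"
      and y: "\<And>i. i \<in> I \<Longrightarrow> \<bar>\<Sum>j\<in>I. A i j * a j\<bar> \<le> Y" and "0 \<le> Y" and "i0 \<in> I"
    define w where "w i = \<rho> ^ grid_dist i i0" for i
    define v where "v i = w i * a i" for i
    define V where "V = (\<Sum>i\<in>I. (v i)\<^sup>2)"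
    define near where "near i j \<longleftrightarrow> (\<forall>l. \<bar>int (i l) - int (j l)\<bar> \<le> int m)" for i j :: "'d \<Rightarrow> nat"
    have near_sym: "near i j = near j i" for i j by (simp add: near_def abs_minus_commute)
    have A0: "A i j = 0" if "i \<in> I" "j \<in> I" "\<not> near i j" for i j
      using that band unfolding near_def by (meson not_le)
    have w_sq: "(w i)\<^sup>2 = (\<rho>\<^sup>2) ^ grid_dist i i0" for i
      unfolding w_def power_mult[symmetric] by (simp add: mult.commute)
    have w: "0 < w i" for i using \<rho> by (simp add: w_def)
    have w_ratio: "w i \<le> (1 + \<epsilon>) * w j" if "near i j" for i j
    proof -
      have "grid_dist j i \<le> D"
        unfolding grid_dist_def D_def
        by (rule order.trans[OF sum_bounded_above[where K = m]])
          (use that in \<open>auto simp: near_def abs_minus_commute nat_le_iff\<close>)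
      then have "grid_dist j i0 \<le> D + grid_dist i i0"
        using grid_dist_triangle[of j i0 i] by simp
      then have "\<rho> ^ (D + grid_dist i i0) \<le> w j"
        unfolding w_def using \<rho> by (intro power_decreasing) auto
      then have "\<rho> ^ D * w i \<le> w j" by (simp add: w_def power_add)
      then have "(1 + \<epsilon>) * (\<rho> ^ D * w i) \<le> (1 + \<epsilon>) * w j" using \<epsilon> by (intro mult_left_mono) auto
      moreover have "1 * w i \<le> (1 + \<epsilon>) * \<rho> ^ D * w i" using \<rho>D w[of i] by (intro mult_right_mono) auto
      ultimately show ?thesis by (simp add: mult.assoc)
    qed
    have w_diff: "\<bar>w j - w i\<bar> \<le> \<epsilon> * w j" if "near i j" for i j
    proof -
      have "w j \<le> (1 + \<epsilon>) * w i" using w_ratio that near_sym by blast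
      then have "(1 - \<epsilon>) * w j \<le> w i"
      proof (cases "\<epsilon> \<le> 1")
        case True
        then have "(1 - \<epsilon>) * w j \<le> (1 - \<epsilon>) * ((1 + \<epsilon>) * w i)"
          using \<open>w j \<le> (1 + \<epsilon>) * w i\<close> by (intro mult_left_mono) auto
        also have "\<dots> = w i - \<epsilon>\<^sup>2 * w i" by (simp add: algebra_simps power2_eq_square)
        also have "\<dots> \<le> w i" using w[of i] by simp
        finally show ?thesis .
      next
        case False
        then have "(1 - \<epsilon>) * w j \<le> 0" using w[of j] by (simp add: mult_le_0_iff)
        then show ?thesis using w[of i] by linarith
      qed
      then show ?thesis using w_ratio[OF that] by (simp add: algebra_simps abs_le_iff)
    qed
    have row: "(\<Sum>j\<in>I. of_bool (near i j)) \<le> B" for i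
      using grid_ball_bound[OF fin, of i m] fin by (simp add: B_def near_def Int_def)
    have band_sum: "(\<Sum>i\<in>I. \<Sum>j\<in>I. of_bool (near i j) * (v i)\<^sup>2) \<le> B * V"
    proof -
      have "(\<Sum>i\<in>I. \<Sum>j\<in>I. of_bool (near i j) * (v i)\<^sup>2) = (\<Sum>i\<in>I. (\<Sum>j\<in>I. of_bool (near i j)) * (v i)\<^sup>2)"
        unfolding sum_distrib_right ..
      also have "\<dots> \<le> (\<Sum>i\<in>I. B * (v i)\<^sup>2)"
        using row by (intro sum_mono mult_right_mono) auto
      finally show ?thesis by (simp add: V_def sum_distrib_left)
    qed
    have band_sum': "(\<Sum>i\<in>I. \<Sum>j\<in>I. of_bool (near i j) * (v j)\<^sup>2) \<le> B * V"
      using band_sum by (subst sum.swap) (simp add: near_sym)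
    define R where "R = (\<Sum>i\<in>I. \<Sum>j\<in>I. w i * a i * A i j * a j * (w j - w i))"
    \<comment> \<open>The chain bounds the energy of \<open>v\<close> by \<open>3 / 4 * \<alpha> * V\<close> plus the contribution of the data:
      a quarter of \<open>\<alpha> * V\<close> comes from Young's inequality, a half from the commutator.\<close>
    have "(\<Sum>i\<in>I. \<Sum>j\<in>I. v i * A i j * v j) = (\<Sum>i\<in>I. w i * v i * (\<Sum>j\<in>I. A i j * a j)) + R"
      unfolding R_def v_def sum.distrib[symmetric] sum_distrib_left
      by (intro sum.cong refl) (simp add: algebra_simps)
    also have "(\<Sum>i\<in>I. w i * v i * (\<Sum>j\<in>I. A i j * a j)) \<le> (\<Sum>i\<in>I. \<alpha> / 4 * (v i)\<^sup>2 + (w i)\<^sup>2 * Y\<^sup>2 / \<alpha>)"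
    proof (rule sum_mono)
      fix i assume "i \<in> I"
      have "w i * v i * (\<Sum>j\<in>I. A i j * a j) \<le> \<bar>w i * v i * (\<Sum>j\<in>I. A i j * a j)\<bar>" by simp
      also have "\<dots> \<le> w i * \<bar>v i\<bar> * Y"
        using w[of i] y[OF \<open>i \<in> I\<close>] by (simp add: abs_mult mult_left_mono)
      also have "\<dots> \<le> \<alpha> / 4 * (v i)\<^sup>2 + (w i)\<^sup>2 * Y\<^sup>2 / \<alpha>"
      proof -
        have "0 \<le> (\<alpha> * \<bar>v i\<bar> - 2 * w i * Y)\<^sup>2" by simp
        also have "\<dots> = 4 * \<alpha> * (\<alpha> / 4 * (v i)\<^sup>2 + (w i)\<^sup>2 * Y\<^sup>2 / \<alpha> - w i * \<bar>v i\<bar> * Y)"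
          using assms(1) by (simp add: power2_diff power2_eq_square algebra_simps)
        finally show ?thesis using assms(1) by (simp add: zero_le_mult_iff)
      qed
      finally show "w i * v i * (\<Sum>j\<in>I. A i j * a j) \<le> \<alpha> / 4 * (v i)\<^sup>2 + (w i)\<^sup>2 * Y\<^sup>2 / \<alpha>" .
    qed
    also have "\<dots> = \<alpha> / 4 * V + (\<Sum>i\<in>I. (\<rho>\<^sup>2) ^ grid_dist i i0) * Y\<^sup>2 / \<alpha>"
      by (simp add: V_def sum.distrib flip: w_sq sum_distrib_left sum_distrib_right sum_divide_distrib)
    also have "(\<Sum>i\<in>I. (\<rho>\<^sup>2) ^ grid_dist i i0) * Y\<^sup>2 / \<alpha> \<le> W * Y\<^sup>2 / \<alpha>"
      using sum_power_grid_dist_le[OF \<rho>2 fin, of i0] assms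
      by (intro divide_right_mono mult_right_mono) (auto simp: W_def)
    also have "R \<le> (\<Sum>i\<in>I. \<Sum>j\<in>I. \<epsilon> * \<Gamma> * (of_bool (near i j) * (v i)\<^sup>2 + of_bool (near i j) * (v j)\<^sup>2) / 2)"
      unfolding R_def
    proof (intro sum_mono)
      fix i j assume ij: "i \<in> I" "j \<in> I"
      show "w i * a i * A i j * a j * (w j - w i)
          \<le> \<epsilon> * \<Gamma> * (of_bool (near i j) * (v i)\<^sup>2 + of_bool (near i j) * (v j)\<^sup>2) / 2"
      proof (cases "near i j")
        case False
        then show ?thesis using A0[OF ij] by simp
      next
        case True
        have "w i * a i * A i j * a j * (w j - w i) \<le> \<bar>w i * a i * A i j * a j * (w j - w i)\<bar>" by simp
        also have "\<dots> = \<bar>v i\<bar> * \<bar>a j\<bar> * (\<bar>A i j\<bar> * \<bar>w j - w i\<bar>)" by (simp add: v_def abs_mult)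
        also have "\<dots> \<le> \<bar>v i\<bar> * \<bar>a j\<bar> * (\<Gamma> * (\<epsilon> * w j))"
          using w_diff[OF True] bd[OF ij] assms by (intro mult_left_mono mult_mono) auto
        also have "\<dots> = \<epsilon> * \<Gamma> * (\<bar>v i\<bar> * \<bar>v j\<bar>)" using w[of j] by (simp add: v_def abs_mult)
        also have "\<dots> \<le> \<epsilon> * \<Gamma> * (((v i)\<^sup>2 + (v j)\<^sup>2) / 2)"
          using sum_squares_bound[of "\<bar>v i\<bar>" "\<bar>v j\<bar>"] \<epsilon> assms by (intro mult_left_mono) auto
        finally show ?thesis using True by simp
      qed
    qed
    also have "\<dots> = \<epsilon> * \<Gamma> / 2 * ((\<Sum>i\<in>I. \<Sum>j\<in>I. of_bool (near i j) * (v i)\<^sup>2)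
        + (\<Sum>i\<in>I. \<Sum>j\<in>I. of_bool (near i j) * (v j)\<^sup>2))"
      by (simp only: sum_distrib_left sum.distrib[symmetric])
        (intro sum.cong refl; simp add: algebra_simps)
    also have "\<dots> \<le> \<epsilon> * \<Gamma> / 2 * (B * V + B * V)"
      using band_sum band_sum' \<epsilon> assms by (intro mult_left_mono add_mono) auto
    also have "\<dots> = \<epsilon> * (\<Gamma> * B) * V" by simp
    also have "\<dots> \<le> \<alpha> / 2 * V"
      using \<epsilon>2 by (intro mult_right_mono) (auto simp: V_def intro!: sum_nonneg)
    finally have "\<alpha> * V \<le> \<alpha> / 4 * V + W * Y\<^sup>2 / \<alpha> + \<alpha> / 2 * V"
      using coer[of v] by (simp add: V_def)
    then have "\<alpha> * V \<le> 4 * (W * Y\<^sup>2 / \<alpha>)" by linarith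
    then have "V \<le> 4 * (W * Y\<^sup>2 / \<alpha>) / \<alpha>"
      using assms(1) by (simp add: pos_le_divide_eq mult_ac)
    also have "\<dots> = 4 * W * Y\<^sup>2 / \<alpha>\<^sup>2" by (simp add: power2_eq_square)
    also have "\<dots> = (C * Y)\<^sup>2" using W by (simp add: C_def power_mult_distrib power_divide)
    finally have "V \<le> (C * Y)\<^sup>2" .
    moreover have "(a i0)\<^sup>2 \<le> V"
    proof -
      have "a i0 = v i0" by (simp add: v_def w_def grid_dist_def)
      then show ?thesis unfolding V_def
        using member_le_sum[OF \<open>i0 \<in> I\<close>, of "\<lambda>i. (v i)\<^sup>2"] fin by simp
    qed
    ultimately have "(a i0)\<^sup>2 \<le> (C * Y)\<^sup>2" by linarith
    then show "\<bar>a i0\<bar> \<le> C * Y"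
      using abs_le_square_iff[of "a i0" "C * Y"] C \<open>0 \<le> Y\<close> by simp
  qed
qed

section \<open>Bounded functions with compact support\<close>

text \<open>A class that contains the scaling functions and all edge functions, is closed under the operations
  of the Gram--Schmidt process, and consists of integrable functions.\<close>

definition bounded_compact :: "(real \<Rightarrow> real) \<Rightarrow> bool" where
  "bounded_compact f \<longleftrightarrow> f \<in> borel_measurable borel \<and> (\<exists>c. \<forall>x. \<bar>f x\<bar> \<le> c) \<and> (\<exists>R. \<forall>x. R < \<bar>x\<bar> \<longrightarrow> f x = 0)"

lemma bounded_compact_measurable [measurable_dest]: "bounded_compact f \<Longrightarrow> f \<in> borel_measurable borel"
  by (simp add: bounded_compact_def)

lemma bounded_compact_zero: "bounded_compact (\<lambda>x. 0)"
  by (auto simp: bounded_compact_def)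

lemma bounded_compact_add:
  assumes "bounded_compact f" "bounded_compact g"
  shows "bounded_compact (\<lambda>x. f x + g x)"
proof -
  obtain c R d S where "\<And>x. \<bar>f x\<bar> \<le> c" "\<And>x. R < \<bar>x\<bar> \<Longrightarrow> f x = 0"
    "\<And>x. \<bar>g x\<bar> \<le> d" "\<And>x. S < \<bar>x\<bar> \<Longrightarrow> g x = 0"
    using assms unfolding bounded_compact_def by metis
  then have "\<bar>f x + g x\<bar> \<le> c + d" "max R S < \<bar>x\<bar> \<longrightarrow> f x + g x = 0" for x
    by (auto intro: order.trans[OF abs_triangle_ineq add_mono])
  then show ?thesis using assms unfolding bounded_compact_def by (blast intro: borel_measurable_add)
qed

lemma bounded_compact_mult:
  assumes "bounded_compact f" "bounded_compact g"
  shows "bounded_compact (\<lambda>x. f x * g x)"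
proof -
  obtain c R d where *: "\<And>x. \<bar>f x\<bar> \<le> c" "\<And>x. R < \<bar>x\<bar> \<Longrightarrow> f x = 0" "\<And>x. \<bar>g x\<bar> \<le> d"
    using assms unfolding bounded_compact_def by metis
  have "\<bar>f x * g x\<bar> \<le> c * d" for x
    using *(1)[of x] *(3)[of x] by (simp add: abs_mult mult_mono')
  moreover have "R < \<bar>x\<bar> \<longrightarrow> f x * g x = 0" for x using * by auto
  ultimately show ?thesis using assms unfolding bounded_compact_def by (blast intro: borel_measurable_times)
qed

lemma bounded_compact_cmult:
  assumes "bounded_compact f"
  shows "bounded_compact (\<lambda>x. a * f x)"
proof -
  obtain c R where *: "\<And>x. \<bar>f x\<bar> \<le> c" "\<And>x. R < \<bar>x\<bar> \<Longrightarrow> f x = 0"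
    using assms unfolding bounded_compact_def by metis
  then have "\<bar>a * f x\<bar> \<le> \<bar>a\<bar> * c" "R < \<bar>x\<bar> \<longrightarrow> a * f x = 0" for x
    by (auto simp: abs_mult mult_left_mono)
  moreover have "(\<lambda>x. a * f x) \<in> borel_measurable borel"
    using bounded_compact_measurable[OF assms] by simp
  ultimately show ?thesis unfolding bounded_compact_def by blast
qed

lemma bounded_compact_diff:
  "bounded_compact f \<Longrightarrow> bounded_compact g \<Longrightarrow> bounded_compact (\<lambda>x. f x - g x)"
  using bounded_compact_add[of f "\<lambda>x. -1 * g x"] bounded_compact_cmult[of g "-1"] by simp

lemma bounded_compact_sum:
  "(\<And>i. i \<in> I \<Longrightarrow> bounded_compact (f i)) \<Longrightarrow> bounded_compact (\<lambda>x. \<Sum>i\<in>I. f i x)"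
  by (induction I rule: infinite_finite_induct)
    (auto intro: bounded_compact_zero bounded_compact_add)

lemma bounded_compact_affine:
  assumes "bounded_compact f" "c \<noteq> 0"
  shows "bounded_compact (\<lambda>x. f (t + c * x))"
proof -
  obtain b R where *: "\<And>x. \<bar>f x\<bar> \<le> b" "\<And>x. R < \<bar>x\<bar> \<Longrightarrow> f x = 0"
    using assms unfolding bounded_compact_def by metis
  have "f (t + c * x) = 0" if "(\<bar>t\<bar> + R) / \<bar>c\<bar> < \<bar>x\<bar>" for x
  proof (rule *(2))
    have "\<bar>t\<bar> + R < \<bar>c * x\<bar>" using that assms(2) by (simp add: pos_divide_less_eq abs_mult mult.commute)
    then show "R < \<bar>t + c * x\<bar>" by linarith
  qed
  moreover have "(\<lambda>x. f (t + c * x)) \<in> borel_measurable borel"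
    using bounded_compact_measurable[OF assms(1)] by simp
  ultimately show ?thesis unfolding bounded_compact_def using * by blast
qed

lemma bounded_compact_integrable:
  assumes "bounded_compact f"
  shows "integrable lborel f"
proof -
  obtain c R where *: "\<And>x. \<bar>f x\<bar> \<le> c" "\<And>x. R < \<bar>x\<bar> \<Longrightarrow> f x = 0"
    using assms unfolding bounded_compact_def by metis
  have fin: "emeasure lborel {- R..R} < \<infinity>" by (simp add: emeasure_lborel_Icc_eq)
  have zero: "f x = 0" if "x \<notin> {- R..R}" for x using *(2)[of x] that by auto
  show ?thesis
    by (rule integrableI_bounded_set[where A = "{- R..R}" and B = c])
      (use * zero fin bounded_compact_measurable[OF assms] in auto)
qed

text \<open>This is what keeps the denominators of the Gram--Schmidt process away from zero.\<close>

lemma integral_square_pos: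
  assumes "bounded_compact u" "open T" "T \<noteq> {}" and nz: "\<And>x. x \<in> T \<Longrightarrow> u x \<noteq> 0"
  shows "0 < (LINT x|lborel. u x * u x)"
proof -
  have int: "integrable lborel (\<lambda>x. u x * u x)"
    by (intro bounded_compact_integrable bounded_compact_mult assms)
  have "(LINT x|lborel. u x * u x) \<noteq> 0"
  proof
    assume "(LINT x|lborel. u x * u x) = 0"
    then have "AE x in lborel. u x * u x = 0"
      using integral_nonneg_eq_0_iff_AE[OF int] by simp
    then have ae: "AE x in lborel. x \<notin> T" by eventually_elim (use nz in auto)
    obtain x e where "x \<in> T" "0 < e" "ball x e \<subseteq> T"
      using assms(2,3) by (meson ex_in_conv openE)
    then have "AE y in lborel. y \<notin> {x - e<..<x + e}"
      using ae by (auto elim!: eventually_mono simp: subset_eq dist_real_def abs_less_iff)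
    then have "emeasure lborel {x - e<..<x + e} = 0"
      by (subst (asm) AE_iff_measurable[where N = "{x - e<..<x + e}"]) auto
    then show False using \<open>0 < e\<close> by simp
  qed
  moreover have "0 \<le> (LINT x|lborel. u x * u x)" by (intro Bochner_Integration.integral_nonneg) simp
  ultimately show ?thesis by linarith
qed

lemma integral_lincomb_mult:
  assumes "bounded_compact e" "\<And>j. j \<in> I \<Longrightarrow> bounded_compact (v j)" "bounded_compact g"
  shows "(LINT x|lborel. (e x - (\<Sum>j\<in>I. c j * v j x)) * g x)
    = (LINT x|lborel. e x * g x) - (\<Sum>j\<in>I. c j * (LINT x|lborel. v j x * g x))"
proof -
  have [simp]: "integrable lborel (\<lambda>x. e x * g x)" "\<And>j. j \<in> I \<Longrightarrow> integrable lborel (\<lambda>x. v j x * g x)"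
    using assms by (auto intro!: bounded_compact_integrable bounded_compact_mult)
  have "(LINT x|lborel. (e x - (\<Sum>j\<in>I. c j * v j x)) * g x)
    = (LINT x|lborel. e x * g x - (\<Sum>j\<in>I. c j * (v j x * g x)))"
    by (simp add: left_diff_distrib sum_distrib_right mult.assoc)
  also have "\<dots> = (LINT x|lborel. e x * g x) - (LINT x|lborel. (\<Sum>j\<in>I. c j * (v j x * g x)))"
    by (intro Bochner_Integration.integral_diff Bochner_Integration.integrable_sum) auto
  also have "(LINT x|lborel. (\<Sum>j\<in>I. c j * (v j x * g x))) = (\<Sum>j\<in>I. c j * (LINT x|lborel. v j x * g x))"
    by (subst Bochner_Integration.integral_sum) auto
  finally show ?thesis .
qed

lemma half_line_inner_eq:
  assumes "\<And>x. x < 0 \<Longrightarrow> f x = 0"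
  shows "half_line_inner f g = (LINT x|lborel. f x * g x)"
  unfolding half_line_inner_def set_lebesgue_integral_def
  by (intro Bochner_Integration.integral_cong) (auto simp: assms indicator_def)

section \<open>Orthonormality of the edge functions\<close>

text \<open>The properties of a Daubechies scaling function that the boundary construction rests on.  They are
  stated symmetrically in the two ends of the support, so that the reflection \<open>\<lambda>y. \<phi> (1 - y)\<close>
  satisfies them as well and every result on the left edge also holds at the right edge.\<close>

locale orthonormal_shifts =
  fixes N :: nat and \<phi> :: "real \<Rightarrow> real"
  assumes cont: "continuous_on UNIV \<phi>"
    and support: "\<phi> x \<noteq> 0 \<Longrightarrow> 1 - real N \<le> x \<and> x \<le> real N"
    and left_end: "\<exists>x. 1 - real N < x \<and> x < 2 - real N \<and> \<phi> x \<noteq> 0"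
    and right_end: "\<exists>x. real N - 1 < x \<and> x < real N \<and> \<phi> x \<noteq> 0"
    and orthonormal: "(LINT x|lborel. \<phi> x * \<phi> (x - of_int m)) = (if m = 0 then 1 else 0)"
begin

lemma mirror: "orthonormal_shifts N (\<lambda>y. \<phi> (1 - y))"
proof
  show "continuous_on UNIV (\<lambda>y. \<phi> (1 - y))"
    using cont by (auto intro!: continuous_intros continuous_on_compose2[OF cont])
  show "1 - real N \<le> x \<and> x \<le> real N" if "\<phi> (1 - x) \<noteq> 0" for x using support[OF that] by auto
  show "\<exists>x. 1 - real N < x \<and> x < 2 - real N \<and> \<phi> (1 - x) \<noteq> 0"
  proof -
    obtain x where "real N - 1 < x \<and> x < real N \<and> \<phi> x \<noteq> 0" using right_end by blast
    then show ?thesis by (intro exI[of _ "1 - x"]) auto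
  qed
  show "\<exists>x. real N - 1 < x \<and> x < real N \<and> \<phi> (1 - x) \<noteq> 0"
  proof -
    obtain x where "1 - real N < x \<and> x < 2 - real N \<and> \<phi> x \<noteq> 0" using left_end by blast
    then show ?thesis by (intro exI[of _ "1 - x"]) auto
  qed
  show "(LINT x|lborel. \<phi> (1 - x) * \<phi> (1 - (x - of_int m))) = (if m = 0 then 1 else 0)" for m
    using orthonormal[of "- m"]
      lborel_integral_real_affine[of "-1" "\<lambda>x. \<phi> (1 - x) * \<phi> (1 - (x - of_int m))" 1]
    by (simp add: algebra_simps)
qed

lemma shifts_orthonormal:
  "(LINT x|lborel. \<phi> (x - of_int a) * \<phi> (x - of_int b)) = (if a = b then 1 else 0)"
proof -
  have "(LINT x|lborel. \<phi> (x - of_int a) * \<phi> (x - of_int b)) = (LINT x|lborel. \<phi> x * \<phi> (x - of_int (b - a)))"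
    using lborel_integral_real_affine[of 1 "\<lambda>x. \<phi> (x - of_int a) * \<phi> (x - of_int b)" "of_int a"]
    by (simp add: algebra_simps)
  also have "\<dots> = (if b - a = 0 then 1 else 0)" by (rule orthonormal)
  finally show ?thesis by simp
qed

lemma bounded_compact_phi: "bounded_compact \<phi>"
proof -
  have "compact (\<phi> ` {1 - real N..real N})"
    by (intro compact_continuous_image continuous_on_subset[OF cont]) auto
  then have "bounded (\<phi> ` {1 - real N..real N})" by (rule compact_imp_bounded)
  then obtain c where c: "\<And>x. x \<in> {1 - real N..real N} \<Longrightarrow> \<bar>\<phi> x\<bar> \<le> c"
    unfolding bounded_iff by (metis imageI real_norm_def)
  have "\<bar>\<phi> x\<bar> \<le> max c 0" for x using c[of x] support[of x] by (cases "\<phi> x = 0") auto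
  moreover have "real N + 1 < \<bar>x\<bar> \<longrightarrow> \<phi> x = 0" for x
    using support[of x] by (cases "\<phi> x = 0") (auto simp: abs_if split: if_splits)
  ultimately show ?thesis
    using borel_measurable_continuous_onI[OF cont] unfolding bounded_compact_def by blast
qed

lemma bounded_compact_shift: "bounded_compact (\<lambda>x. \<phi> (x - a))"
  using bounded_compact_affine[OF bounded_compact_phi, of 1 "- a"] by simp

lemma bounded_compact_edge: "bounded_compact (cdv_edge N \<phi> k)"
proof -
  have "bounded_compact (\<lambda>x. \<Sum>n = k..2 * N - 2. real (n choose k) * \<phi> (x - (real N - real n - 1)))"
    by (intro bounded_compact_sum bounded_compact_cmult bounded_compact_shift)
  then obtain c R where m: "(\<lambda>x. \<Sum>n = k..2 * N - 2. real (n choose k) * \<phi> (x - (real N - real n - 1))) \<in> borel_measurable borel"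
    and *: "\<And>x. \<bar>\<Sum>n = k..2 * N - 2. real (n choose k) * \<phi> (x - (real N - real n - 1))\<bar> \<le> c"
      "\<And>x. R < \<bar>x\<bar> \<Longrightarrow> (\<Sum>n = k..2 * N - 2. real (n choose k) * \<phi> (x - (real N - real n - 1))) = 0"
    unfolding bounded_compact_def by blast
  have eq: "cdv_edge N \<phi> k = (\<lambda>x. if 0 \<le> x then \<Sum>n = k..2 * N - 2. real (n choose k) * \<phi> (x - (real N - real n - 1)) else 0)"
    by (auto simp: cdv_edge_def fun_eq_iff algebra_simps)
  have "0 \<le> c" using *(1)[of 0] by linarith
  then have "\<bar>cdv_edge N \<phi> k x\<bar> \<le> c" "R < \<bar>x\<bar> \<longrightarrow> cdv_edge N \<phi> k x = 0" for x
    using * unfolding eq by auto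
  moreover have "cdv_edge N \<phi> k \<in> borel_measurable borel"
    unfolding eq using m by (intro measurable_If) auto
  ultimately show ?thesis unfolding bounded_compact_def by blast
qed

lemma edge_support:
  assumes "k < N" "cdv_edge N \<phi> (N - 1 - k) x \<noteq> 0"
  shows "0 \<le> x \<and> x \<le> real (N + k)"
proof -
  have x: "0 \<le> x" using assms(2) by (auto simp: cdv_edge_def split: if_splits)
  then obtain n where n: "n \<in> {N - 1 - k..2 * N - 2}" "real (n choose (N - 1 - k)) * \<phi> (x + real n - real N + 1) \<noteq> 0"
    using assms(2) sum.not_neutral_contains_not_neutral unfolding cdv_edge_def by (metis (no_types, lifting))
  then have "x + real n - real N + 1 \<le> real N" using support by auto
  moreover have "N \<le> n + k + 1" using n(1) assms(1) by auto
  then have "real N \<le> real n + real k + 1" by linarith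
  ultimately show ?thesis using x by simp
qed

text \<open>The edge functions have a triangular structure: the one with index \<open>N - 1 - k\<close> reaches one unit
  further to the right than the one with index \<open>N - k\<close>, and on this last unit it is a single
  translate of \<open>\<phi>\<close>, all other translates having ended already.  Since \<open>\<phi>\<close> does not vanish near the
  end of its support, the edge functions are linearly independent.\<close>

lemma edge_near_right_end:
  assumes "k < N" "real (N + k) - 1 < x"
  shows "cdv_edge N \<phi> (N - 1 - k) x = \<phi> (x - real k)"
proof -
  define p where "p = N - 1 - k"
  have p: "p \<le> 2 * N - 2" "real p = real N - 1 - real k" using assms(1) by (auto simp: p_def)
  have "cdv_edge N \<phi> p x = (\<Sum>n = p..2 * N - 2. real (n choose p) * \<phi> (x + real n - real N + 1))"
    using assms by (simp add: cdv_edge_def)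
  also have "\<dots> = (\<Sum>n = p..2 * N - 2. if n = p then \<phi> (x - real k) else 0)"
  proof (rule sum.cong[OF refl])
    fix n assume "n \<in> {p..2 * N - 2}"
    show "real (n choose p) * \<phi> (x + real n - real N + 1) = (if n = p then \<phi> (x - real k) else 0)"
    proof (cases "n = p")
      case True
      have "x + real p - real N + 1 = x - real k" using p(2) by simp
      then show ?thesis unfolding True by (simp only: binomial_n_n of_nat_1 mult_1 if_True simp_thms)
    next
      case False
      then have "real p + 1 \<le> real n" using \<open>n \<in> _\<close> by auto
      then have "real N < x + real n - real N + 1" using assms p(2) by simp
      then show ?thesis using support[of "x + real n - real N + 1"] False by auto
    qed
  qed
  also have "\<dots> = \<phi> (x - real k)" using p by simp
  finally show ?thesis by (simp add: p_def)
qed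

text \<open>The cut-off at 0 in the edge function has no effect on the integral, because the interior
  translate vanishes on the negative half line; what remains is orthonormality of the translates on
  the whole line.\<close>

lemma edge_orthogonal_interior:
  assumes "k < N" "N \<le> m"
  shows "(LINT x|lborel. cdv_edge N \<phi> (N - 1 - k) x * \<phi> (x - real m)) = 0"
proof -
  define p where "p = N - 1 - k"
  have "cdv_edge N \<phi> p x * \<phi> (x - real m)
      = (\<Sum>n = p..2 * N - 2. real (n choose p) * (\<phi> (x - of_int (int N - int n - 1)) * \<phi> (x - of_int (int m))))" for x
  proof (cases "0 \<le> x")
    case True
    have "x - of_int (int N - int n - 1) = x + real n - real N + 1" for n by simp
    then show ?thesis using True
      by (simp only: cdv_edge_def sum_distrib_right mult.assoc if_True of_int_of_nat_eq)
  next
    case False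
    then have "\<phi> (x - real m) = 0" using support[of "x - real m"] assms by force
    then show ?thesis by simp
  qed
  then have "(LINT x|lborel. cdv_edge N \<phi> p x * \<phi> (x - real m))
     = (\<Sum>n = p..2 * N - 2. real (n choose p) * (LINT x|lborel. \<phi> (x - of_int (int N - int n - 1)) * \<phi> (x - of_int (int m))))"
    by (simp only:) (subst Bochner_Integration.integral_sum,
      auto intro!: bounded_compact_integrable bounded_compact_mult bounded_compact_shift integrable_mult_right)
  also have "\<dots> = 0"
    unfolding shifts_orthonormal using assms by (intro sum.neutral) auto
  finally show ?thesis by (simp add: p_def)
qed

text \<open>The vector that is normalised in step \<open>k\<close> of the Gram--Schmidt process.\<close>

definition residual :: "nat \<Rightarrow> real \<Rightarrow> real" where
  "residual k x = cdv_edge N \<phi> (N - 1 - k) x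
     - (\<Sum>j<k. half_line_inner (cdv_edge N \<phi> (N - 1 - k)) (cdv_left N \<phi> j) * cdv_left N \<phi> j x)"

lemma cdv_left_eq: "cdv_left N \<phi> k x = residual k x / sqrt (half_line_inner (residual k) (residual k))"
  by (subst cdv_left.simps) (simp add: Let_def residual_def[abs_def])

lemma bounded_compact_left: "bounded_compact (cdv_left N \<phi> k)"
proof (induction k rule: less_induct)
  case (less k)
  have "bounded_compact (\<lambda>x. 1 / sqrt (half_line_inner (residual k) (residual k)) * residual k x)"
    unfolding residual_def using less
    by (intro bounded_compact_cmult bounded_compact_diff bounded_compact_sum bounded_compact_edge) auto
  then show ?case by (simp add: cdv_left_eq[abs_def])
qed

lemma bounded_compact_residual: "bounded_compact (residual k)"
  unfolding residual_def[abs_def]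
  by (intro bounded_compact_cmult bounded_compact_diff bounded_compact_sum bounded_compact_edge bounded_compact_left)

lemma left_support:
  assumes "k < N" "cdv_left N \<phi> k x \<noteq> 0"
  shows "0 \<le> x \<and> x \<le> real (N + k)"
  using assms
proof (induction k rule: less_induct)
  case (less k)
  show ?case
  proof (rule ccontr)
    assume out: "\<not> (0 \<le> x \<and> x \<le> real (N + k))"
    then have "cdv_edge N \<phi> (N - 1 - k) x = 0" using edge_support less.prems by blast
    moreover have "cdv_left N \<phi> j x = 0" if "j < k" for j
      using less.IH[OF that] less.prems out that by force
    ultimately have "residual k x = 0" by (simp add: residual_def)
    then show False using less.prems by (simp add: cdv_left_eq)
  qed
qed

lemma residual_zero: "k < N \<Longrightarrow> x < 0 \<Longrightarrow> residual k x = 0"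
  unfolding residual_def using edge_support[of k x] left_support[of _ x]
  by (force intro!: sum.neutral)

lemma residual_inner:
  "k < N \<Longrightarrow> half_line_inner (residual k) (residual k) = (LINT x|lborel. residual k x * residual k x)"
  by (rule half_line_inner_eq) (rule residual_zero)

text \<open>On the last unit of its support the residual equals \<open>\<phi> (x - k)\<close>, because the functions
  constructed so far end before it.\<close>

lemma residual_norm_pos:
  assumes "k < N"
  shows "0 < (LINT x|lborel. residual k x * residual k x)"
proof (rule integral_square_pos[OF bounded_compact_residual])
  let ?T = "{real (N + k) - 1<..<real (N + k)} \<inter> {x. \<phi> (x - real k) \<noteq> 0}"
  have "continuous_on UNIV (\<lambda>x. \<phi> (x - real k))"
    by (intro continuous_on_compose2[OF cont] continuous_intros) auto
  then show "open ?T" by (intro open_Int open_Collect_neq) auto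
  obtain x where "real N - 1 < x" "x < real N" "\<phi> x \<noteq> 0" using right_end by blast
  then have "x + real k \<in> ?T" by auto
  then show "?T \<noteq> {}" by blast
  fix x assume x: "x \<in> ?T"
  have "cdv_left N \<phi> j x = 0" if "j < k" for j
    using left_support[of j x] that assms x by force
  then show "residual k x \<noteq> 0"
    using x edge_near_right_end[OF assms] by (simp add: residual_def)
qed

lemma left_mult_integral:
  assumes "k < N" "bounded_compact g"
  shows "(LINT x|lborel. cdv_left N \<phi> k x * g x) =
    ((LINT x|lborel. cdv_edge N \<phi> (N - 1 - k) x * g x)
      - (\<Sum>j<k. (LINT x|lborel. cdv_edge N \<phi> (N - 1 - k) x * cdv_left N \<phi> j x) * (LINT x|lborel. cdv_left N \<phi> j x * g x)))
     / sqrt (LINT x|lborel. residual k x * residual k x)"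
proof -
  have e0: "cdv_edge N \<phi> (N - 1 - k) x = 0" if "x < 0" for x
    using edge_support[OF assms(1), of x] that by force
  have e_inner: "half_line_inner (cdv_edge N \<phi> (N - 1 - k)) h = (LINT x|lborel. cdv_edge N \<phi> (N - 1 - k) x * h x)" for h
    by (rule half_line_inner_eq) (rule e0)
  have "(LINT x|lborel. cdv_left N \<phi> k x * g x)
    = (LINT x|lborel. residual k x * g x) / sqrt (LINT x|lborel. residual k x * residual k x)"
    by (simp add: cdv_left_eq residual_inner[OF assms(1)])
  also have "(LINT x|lborel. residual k x * g x) = (LINT x|lborel. cdv_edge N \<phi> (N - 1 - k) x * g x)
      - (\<Sum>j<k. (LINT x|lborel. cdv_edge N \<phi> (N - 1 - k) x * cdv_left N \<phi> j x) * (LINT x|lborel. cdv_left N \<phi> j x * g x))"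
    unfolding residual_def e_inner
    by (intro integral_lincomb_mult bounded_compact_edge bounded_compact_left assms)
  finally show ?thesis .
qed

lemma left_orthogonal_interior:
  assumes "k < N" "N \<le> m"
  shows "(LINT x|lborel. cdv_left N \<phi> k x * \<phi> (x - real m)) = 0"
  using assms(1)
proof (induction k rule: less_induct)
  case (less k)
  then have "(LINT x|lborel. cdv_left N \<phi> j x * \<phi> (x - real m)) = 0" if "j < k" for j
    using that by auto
  then show ?case
    unfolding left_mult_integral[OF less.prems bounded_compact_shift]
      edge_orthogonal_interior[OF less.prems assms(2)]
    by simp
qed

lemma left_orthonormal:
  assumes "i < N" "j < N"
  shows "(LINT x|lborel. cdv_left N \<phi> i x * cdv_left N \<phi> j x) = (if i = j then 1 else 0)"
proof -
  have "\<forall>i<k. \<forall>j<k. (LINT x|lborel. cdv_left N \<phi> i x * cdv_left N \<phi> j x) = (if i = j then 1 else 0)"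
    if "k \<le> N" for k
    using that
  proof (induction k)
    case (Suc k)
    then have k: "k < N" by simp
    have IH: "(LINT x|lborel. cdv_left N \<phi> i x * cdv_left N \<phi> j x) = (if i = j then 1 else 0)"
      if "i < k" "j < k" for i j using Suc that by simp
    have orth: "(LINT x|lborel. cdv_left N \<phi> k x * cdv_left N \<phi> i x) = 0" if "i < k" for i
    proof -
      let ?c = "\<lambda>j. (LINT x|lborel. cdv_edge N \<phi> (N - 1 - k) x * cdv_left N \<phi> j x)"
      have "(\<Sum>j<k. ?c j * (LINT x|lborel. cdv_left N \<phi> j x * cdv_left N \<phi> i x))
          = (\<Sum>j<k. if j = i then ?c i else 0)"
        by (intro sum.cong refl) (use IH that in auto)
      also have "\<dots> = ?c i" using that by simp
      finally show ?thesis
        unfolding left_mult_integral[OF k bounded_compact_left] by simp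
    qed
    have orth': "(LINT x|lborel. cdv_left N \<phi> i x * cdv_left N \<phi> k x) = 0" if "i < k" for i
      using orth[OF that] by (simp add: mult.commute)
    have "(LINT x|lborel. cdv_left N \<phi> k x * cdv_left N \<phi> k x) = 1"
    proof -
      have "(LINT x|lborel. cdv_left N \<phi> k x * cdv_left N \<phi> k x)
          = (LINT x|lborel. residual k x * residual k x / (LINT x|lborel. residual k x * residual k x))"
        unfolding cdv_left_eq residual_inner[OF k]
        using residual_norm_pos[OF k] by (intro Bochner_Integration.integral_cong refl) simp
      also have "\<dots> = 1" using residual_norm_pos[OF k] by simp
      finally show ?thesis .
    qed
    then show ?case
      using IH orth orth' by (auto simp: less_Suc_eq)
  qed simp
  from this[of N] show ?thesis using assms by simp
qed

end

section \<open>The basis on the interval\<close>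

text \<open>The functions of \<^const>\<open>cdv_scaling\<close> in the rescaled variable \<open>y = n * x\<close> on \<open>[0, n]\<close>, where
  \<open>n = 2 ^ J\<close>, and without the factor that normalises them.  The cut-off to the interval is left out:
  by \<open>line_basis_support\<close> below it is automatic.\<close>

definition line_basis :: "nat \<Rightarrow> (real \<Rightarrow> real) \<Rightarrow> nat \<Rightarrow> nat \<Rightarrow> real \<Rightarrow> real" where
  "line_basis N \<phi> n k y =
     (if k < N then cdv_left N \<phi> k y
      else if k < n - N then \<phi> (y - real k)
      else cdv_left N (\<lambda>y. \<phi> (1 - y)) (n - k - 1) (real n - y))"

lemma sum_indicator_window:
  fixes y :: real and n N :: nat
  shows "(\<Sum>k<n. of_bool (\<bar>y - real k\<bar> \<le> real N)) \<le> 2 * real N + 1"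
proof -
  have "int ` ({..<n} \<inter> {k. \<bar>y - real k\<bar> \<le> real N}) \<subseteq> {\<lceil>y - real N\<rceil>..\<lfloor>y + real N\<rfloor>}"
  proof (intro subsetI)
    fix z assume "z \<in> int ` ({..<n} \<inter> {k. \<bar>y - real k\<bar> \<le> real N})"
    then have "y - real N \<le> of_int z" "of_int z \<le> y + real N" by auto
    then show "z \<in> {\<lceil>y - real N\<rceil>..\<lfloor>y + real N\<rfloor>}" 
      by (simp only: atLeastAtMost_iff ceiling_le_iff le_floor_iff simp_thms)
  qed
  then have "card (int ` ({..<n} \<inter> {k. \<bar>y - real k\<bar> \<le> real N})) \<le> card {\<lceil>y - real N\<rceil>..\<lfloor>y + real N\<rfloor>}"
    by (intro card_mono) auto
  then have "card ({..<n} \<inter> {k. \<bar>y - real k\<bar> \<le> real N}) \<le> nat (\<lfloor>y + real N\<rfloor> - \<lceil>y - real N\<rceil> + 1)"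
    by (simp add: card_image)
  also have "\<dots> \<le> nat (2 * int N + 1)" by (intro nat_mono) linarith
  finally show ?thesis by simp
qed

context orthonormal_shifts
begin

interpretation mirror: orthonormal_shifts N "\<lambda>y. \<phi> (1 - y)"
  by (rule mirror)

lemma bounded_compact_line_basis: "bounded_compact (line_basis N \<phi> n k)"
  using bounded_compact_left[of k] bounded_compact_shift[of "real k"]
    bounded_compact_affine[OF mirror.bounded_compact_left[of "n - k - 1"], of "-1" "real n"]
  unfolding line_basis_def[abs_def] by (cases "k < N"; cases "k < n - N") simp_all

lemma line_basis_support:
  assumes "2 * N \<le> n" "k < n" "line_basis N \<phi> n k y \<noteq> 0"
  shows "0 \<le> y" "y \<le> real n" "\<bar>y - real k\<bar> \<le> real N"
proof -
  consider "k < N" | "N \<le> k" "k < n - N" | "N \<le> k" "n - N \<le> k" by linarith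
  then have "0 \<le> y \<and> y \<le> real n \<and> \<bar>y - real k\<bar> \<le> real N"
  proof cases
    case 1
    then have "cdv_left N \<phi> k y \<noteq> 0" "real k < real N" "2 * real N \<le> real n"
      using assms by (simp_all add: line_basis_def)
    with left_support[OF 1 this(1)] show ?thesis
      unfolding of_nat_add by (intro conjI; linarith)
  next
    case 2
    then have "\<phi> (y - real k) \<noteq> 0" "real N \<le> real k" "real k + real N + 1 \<le> real n"
      using assms by (simp_all add: line_basis_def)
    then show ?thesis using support[of "y - real k"] by auto
  next
    case 3
    have "n - k - 1 < N" using 3 assms by linarith
    moreover have "cdv_left N (\<lambda>y. \<phi> (1 - y)) (n - k - 1) (real n - y) \<noteq> 0"
      using 3 assms by (simp add: line_basis_def)
    ultimately have "0 \<le> real n - y \<and> real n - y \<le> real (N + (n - k - 1))"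
      by (rule mirror.left_support)
    moreover have "real (N + (n - k - 1)) = real N + real n - real k - 1"
      "real n \<le> real k + real N" "real k + 1 \<le> real n" "2 * real N \<le> real n"
      using 3 assms by (simp_all add: of_nat_diff)
    ultimately show ?thesis by linarith
  qed
  then show "0 \<le> y" "y \<le> real n" "\<bar>y - real k\<bar> \<le> real N" by blast+
qed

lemma line_basis_bounded:
  obtains C where "0 \<le> C" "\<And>n k y. \<lbrakk>2 * N \<le> n; k < n\<rbrakk> \<Longrightarrow> \<bar>line_basis N \<phi> n k y\<bar> \<le> C"
proof -
  obtain c where c: "\<And>y. \<bar>\<phi> y\<bar> \<le> c" using bounded_compact_phi unfolding bounded_compact_def by blast
  obtain l where l: "\<And>k y. \<bar>cdv_left N \<phi> k y\<bar> \<le> l k"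
    using bounded_compact_left unfolding bounded_compact_def by metis
  obtain r where r: "\<And>k y. \<bar>cdv_left N (\<lambda>y. \<phi> (1 - y)) k y\<bar> \<le> r k"
    using mirror.bounded_compact_left unfolding bounded_compact_def by metis
  have nn: "0 \<le> c" "0 \<le> l k" "0 \<le> r k" for k
    using c[of 0] l[of k 0] r[of k 0] by linarith+
  define C where "C = c + (\<Sum>k<N. l k) + (\<Sum>k<N. r k)"
  have lC: "l k \<le> C" if "k < N" for k
    using member_le_sum[of k "{..<N}" l] that nn by (simp add: C_def add_increasing add_increasing2 sum_nonneg)
  have rC: "r k \<le> C" if "k < N" for k
    using member_le_sum[of k "{..<N}" r] that nn by (simp add: C_def add_increasing sum_nonneg)
  have cC: "c \<le> C" using nn by (simp add: C_def sum_nonneg)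
  show thesis
  proof (rule that[of C])
    show "0 \<le> C" using cC nn by linarith
    fix n k y assume "2 * N \<le> n" "k < n"
    have "n - k - 1 < N" if "\<not> k < n - N" using that \<open>k < n\<close> by linarith
    then show "\<bar>line_basis N \<phi> n k y\<bar> \<le> C"
      using order.trans[OF l[of k y] lC] order.trans[OF c[of "y - real k"] cC]
        order.trans[OF r[of "n - k - 1" "real n - y"] rC]
      by (auto simp: line_basis_def)
  qed
qed

text \<open>The cases are the pairs of left, interior and right indices.  Left and right functions have
  disjoint supports once \<open>n \<ge> 4 * N\<close>; pairs with a right function reduce to the left edge by the
  reflection \<open>y \<mapsto> n - y\<close>, which turns \<open>\<phi> (y - i)\<close> into a translate of \<open>\<lambda>y. \<phi> (1 - y)\<close> by
  \<open>n - i - 1\<close>.\<close>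

lemma line_basis_orthonormal_less:
  assumes "4 * N \<le> n" "j < n" "i < j"
  shows "(LINT y|lborel. line_basis N \<phi> n i y * line_basis N \<phi> n j y) = 0"
proof -
  consider "j < N" | "i < N" "N \<le> j" "j < n - N" | "i < N" "N \<le> j" "n - N \<le> j"
    | "N \<le> i" "j < n - N" | "N \<le> i" "i < n - N" "n - N \<le> j" | "N \<le> i" "n - N \<le> i"
    using assms by linarith
  then show ?thesis
  proof cases
    case 1
    then show ?thesis using assms left_orthonormal[of i j] by (simp add: line_basis_def)
  next
    case 2
    then show ?thesis using assms left_orthogonal_interior[of i j] by (simp add: line_basis_def)
  next
    case 3
    have zero: "line_basis N \<phi> n i y * line_basis N \<phi> n j y = 0" for y
    proof (rule ccontr)
      assume "line_basis N \<phi> n i y * line_basis N \<phi> n j y \<noteq> 0"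
      then have "\<bar>y - real i\<bar> \<le> real N" "\<bar>y - real j\<bar> \<le> real N"
        using line_basis_support(3)[of n] assms by auto
      moreover have "real i + 1 \<le> real N" "real n \<le> real j + real N" "4 * real N \<le> real n"
        using 3 assms by linarith+
      ultimately show False by linarith
    qed
    show ?thesis unfolding zero by simp
  next
    case 4
    then show ?thesis using assms shifts_orthonormal[of "int i" "int j"] by (simp add: line_basis_def)
  next
    case 5
    define k where "k = n - j - 1"
    define m where "m = n - i - 1"
    have km: "k < N" "N \<le> m" using 5 assms by (auto simp: k_def m_def)
    have "(LINT y|lborel. line_basis N \<phi> n i y * line_basis N \<phi> n j y)
      = (LINT y|lborel. line_basis N \<phi> n i (real n + -1 * y) * line_basis N \<phi> n j (real n + -1 * y))"
      by (subst lborel_integral_real_affine[of "-1" _ "real n"]) simp_all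
    also have "\<dots> = (LINT y|lborel. cdv_left N (\<lambda>y. \<phi> (1 - y)) k y * \<phi> (1 - (y - real m)))"
    proof (rule Bochner_Integration.integral_cong[OF refl])
      fix y
      have "real n + -1 * y - real i = 1 - (y - real m)" using 5 assms by (simp add: m_def of_nat_diff)
      moreover have "line_basis N \<phi> n i (real n + -1 * y) = \<phi> (real n + -1 * y - real i)"
        using 5 by (simp add: line_basis_def)
      moreover have "line_basis N \<phi> n j (real n + -1 * y) = cdv_left N (\<lambda>y. \<phi> (1 - y)) k y"
        using 5 assms by (simp add: line_basis_def k_def)
      ultimately show "line_basis N \<phi> n i (real n + -1 * y) * line_basis N \<phi> n j (real n + -1 * y)
        = cdv_left N (\<lambda>y. \<phi> (1 - y)) k y * \<phi> (1 - (y - real m))"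
        by (simp only: mult.commute)
    qed
    also have "\<dots> = 0" by (rule mirror.left_orthogonal_interior[OF km])
    finally show ?thesis .
  next
    case 6
    have "(LINT y|lborel. line_basis N \<phi> n i y * line_basis N \<phi> n j y)
      = (LINT y|lborel. line_basis N \<phi> n i (real n + -1 * y) * line_basis N \<phi> n j (real n + -1 * y))"
      by (subst lborel_integral_real_affine[of "-1" _ "real n"]) simp_all
    also have "\<dots> = (LINT y|lborel. cdv_left N (\<lambda>y. \<phi> (1 - y)) (n - i - 1) y * cdv_left N (\<lambda>y. \<phi> (1 - y)) (n - j - 1) y)"
      using 6 assms by (simp add: line_basis_def)
    also have "\<dots> = 0" using 6 assms by (subst mirror.left_orthonormal) auto
    finally show ?thesis .
  qed
qed

lemma line_basis_normalised:
  assumes "4 * N \<le> n" "i < n"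
  shows "(LINT y|lborel. line_basis N \<phi> n i y * line_basis N \<phi> n i y) = 1"
proof -
  consider "i < N" | "N \<le> i" "i < n - N" | "N \<le> i" "n - N \<le> i" by linarith
  then show ?thesis
  proof cases
    case 1
    then show ?thesis using left_orthonormal[of i i] by (simp add: line_basis_def)
  next
    case 2
    then show ?thesis using shifts_orthonormal[of "int i" "int i"] by (simp add: line_basis_def)
  next
    case 3
    have "(LINT y|lborel. line_basis N \<phi> n i y * line_basis N \<phi> n i y)
      = (LINT y|lborel. line_basis N \<phi> n i (real n + -1 * y) * line_basis N \<phi> n i (real n + -1 * y))"
      by (subst lborel_integral_real_affine[of "-1" _ "real n"]) simp_all
    also have "\<dots> = (LINT y|lborel. cdv_left N (\<lambda>y. \<phi> (1 - y)) (n - i - 1) y * cdv_left N (\<lambda>y. \<phi> (1 - y)) (n - i - 1) y)"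
      using 3 assms by (simp add: line_basis_def)
    also have "\<dots> = 1" using 3 assms by (subst mirror.left_orthonormal) auto
    finally show ?thesis .
  qed
qed

lemma line_basis_orthonormal:
  assumes "4 * N \<le> n" "i < n" "j < n"
  shows "(LINT y|lborel. line_basis N \<phi> n i y * line_basis N \<phi> n j y) = (if i = j then 1 else 0)"
  using line_basis_orthonormal_less[of n i j] line_basis_orthonormal_less[of n j i]
    line_basis_normalised[of n i] assms
  by (cases i j rule: linorder_cases) (simp_all add: mult.commute)

lemma cdv_scaling_eq:
  assumes "2 * N \<le> 2 ^ J" "k < 2 ^ J"
  shows "cdv_scaling N \<phi> J k x = 2 powr (real J / 2) * line_basis N \<phi> (2 ^ J) k (2 ^ J * x)"
proof (cases "x \<in> {0..1}")
  case True
  have "- (2 ^ J * (x - 1)) = real (2 ^ J) - 2 ^ J * x" by (simp add: algebra_simps)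
  then show ?thesis using True by (simp add: cdv_scaling_def line_basis_def cdv_right_def)
next
  case False
  have zero: "line_basis N \<phi> (2 ^ J) k (2 ^ J * x) = 0"
  proof (rule ccontr)
    assume "line_basis N \<phi> (2 ^ J) k (2 ^ J * x) \<noteq> 0"
    from line_basis_support(1,2)[OF assms this] have "0 \<le> 2 ^ J * x" "2 ^ J * x \<le> 2 ^ J * 1" by simp_all
    then show False using False by (simp only: mult_le_cancel_left_pos zero_less_power zero_less_numeral) (simp add: zero_le_mult_iff power_le_zero_eq)
  qed
  show ?thesis unfolding cdv_scaling_def zero using False by (simp only: if_False mult_zero_right)
qed

lemma cdv_scaling_support:
  assumes "2 * N \<le> 2 ^ J" "k < 2 ^ J" "cdv_scaling N \<phi> J k x \<noteq> 0"
  shows "\<bar>2 ^ J * x - real k\<bar> \<le> real N"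
  using line_basis_support(3)[OF assms(1,2), of "2 ^ J * x"] assms by (simp add: cdv_scaling_eq)

lemma bounded_compact_cdv_scaling:
  assumes "2 * N \<le> 2 ^ J" "k < 2 ^ J"
  shows "bounded_compact (cdv_scaling N \<phi> J k)"
  using bounded_compact_cmult[OF bounded_compact_affine[OF bounded_compact_line_basis, of "2 ^ J" "2 ^ J" k 0]]
  by (simp add: cdv_scaling_eq[OF assms, abs_def])

lemma cdv_scaling_orthonormal:
  assumes "4 * N \<le> 2 ^ J" "i < 2 ^ J" "j < 2 ^ J"
  shows "(LINT x|lborel. cdv_scaling N \<phi> J i x * cdv_scaling N \<phi> J j x) = (if i = j then 1 else 0)"
proof -
  have "2 * N \<le> 2 ^ J" using assms by linarith
  have sq: "2 powr (real J / 2) * 2 powr (real J / 2) = (2 ^ J :: real)"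
    by (simp flip: powr_add add: powr_realpow)
  have "(LINT x|lborel. cdv_scaling N \<phi> J i x * cdv_scaling N \<phi> J j x)
      = (LINT x|lborel. 2 ^ J * (line_basis N \<phi> (2 ^ J) i (2 ^ J * x) * line_basis N \<phi> (2 ^ J) j (2 ^ J * x)))"
    using assms \<open>2 * N \<le> 2 ^ J\<close> sq[symmetric]
    by (intro Bochner_Integration.integral_cong refl) (simp add: cdv_scaling_eq mult_ac)
  also have "\<dots> = (LINT y|lborel. line_basis N \<phi> (2 ^ J) i y * line_basis N \<phi> (2 ^ J) j y)"
    by (subst (2) lborel_integral_real_affine[of "2 ^ J" _ 0]) simp_all
  finally show ?thesis using line_basis_orthonormal[OF assms] by simp
qed

text \<open>At each point at most \<open>2 * N + 1\<close> of the functions are nonzero, each of the order of \<open>2 ^ (J / 2)\<close>,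
  and each lives on an interval of length of order \<open>2 ^ (- J)\<close>.  In the projection the two powers of 2
  cancel.\<close>

lemma cdv_scaling_bounds:
  obtains C where "0 \<le> C"
    and "\<And>J x. 2 * N \<le> 2 ^ J \<Longrightarrow> (\<Sum>k<2 ^ J. \<bar>cdv_scaling N \<phi> J k x\<bar>) \<le> C * 2 powr (real J / 2)"
    and "\<And>J k. \<lbrakk>2 * N \<le> 2 ^ J; k < 2 ^ J\<rbrakk>
      \<Longrightarrow> (LINT x|lborel. \<bar>cdv_scaling N \<phi> J k x\<bar>) \<le> C * 2 powr - (real J / 2)"
proof -
  obtain c where c: "0 \<le> c" "\<And>n k y. \<lbrakk>2 * N \<le> n; k < n\<rbrakk> \<Longrightarrow> \<bar>line_basis N \<phi> n k y\<bar> \<le> c"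
    by (rule line_basis_bounded) blast
  have pt: "\<bar>cdv_scaling N \<phi> J k x\<bar> \<le> c * 2 powr (real J / 2) * of_bool (\<bar>2 ^ J * x - real k\<bar> \<le> real N)"
    if "2 * N \<le> 2 ^ J" "k < 2 ^ J" for J k x
  proof (cases "cdv_scaling N \<phi> J k x = 0")
    case False
    then show ?thesis
      using cdv_scaling_support[OF that False] c(2)[OF that, of "2 ^ J * x"]
      by (simp add: cdv_scaling_eq[OF that] abs_mult mult.commute)
  qed (use c in simp)
  show thesis
  proof (rule that[of "c * (2 * real N + 1)"])
    show "0 \<le> c * (2 * real N + 1)" using c by simp
  next
    fix J :: nat and x assume J: "2 * N \<le> 2 ^ J"
    have "(\<Sum>k<2 ^ J. \<bar>cdv_scaling N \<phi> J k x\<bar>)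
        \<le> (\<Sum>k<2 ^ J. c * 2 powr (real J / 2) * of_bool (\<bar>2 ^ J * x - real k\<bar> \<le> real N))"
      by (intro sum_mono pt J) simp
    also have "\<dots> = c * 2 powr (real J / 2) * (\<Sum>k<2 ^ J. of_bool (\<bar>2 ^ J * x - real k\<bar> \<le> real N))"
      by (simp only: sum_distrib_left)
    also have "\<dots> \<le> c * 2 powr (real J / 2) * (2 * real N + 1)"
      using c by (intro mult_left_mono sum_indicator_window) auto
    finally show "(\<Sum>k<2 ^ J. \<bar>cdv_scaling N \<phi> J k x\<bar>) \<le> c * (2 * real N + 1) * 2 powr (real J / 2)"
      by (simp add: mult_ac)
  next
    fix J k :: nat assume J: "2 * N \<le> 2 ^ J" "k < 2 ^ J"
    define a where "a = (real k - real N) / 2 ^ J"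
    define b where "b = (real k + real N) / 2 ^ J"
    have ab: "a \<le> b" by (simp add: a_def b_def divide_right_mono)
    have win: "of_bool (\<bar>2 ^ J * x - real k\<bar> \<le> real N) = (indicator {a..b} x :: real)" for x
      by (auto simp: a_def b_def indicator_def field_simps abs_le_iff)
    have "(LINT x|lborel. \<bar>cdv_scaling N \<phi> J k x\<bar>)
        \<le> (LINT x|lborel. c * 2 powr (real J / 2) * indicator {a..b} x)"
      using pt[OF J] bounded_compact_integrable[OF bounded_compact_cdv_scaling[OF J]]
      by (intro integral_mono) (auto simp: win emeasure_lborel_Icc_eq)
    also have "\<dots> = c * 2 powr (real J / 2) * (2 * real N / 2 ^ J)"
      using ab by (simp add: a_def b_def diff_divide_distrib add_divide_distrib)
    also have "2 powr (real J / 2) / 2 ^ J = (2 powr - (real J / 2) :: real)"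
    proof -
      have "(2::real) ^ J = 2 powr (real J / 2 + real J / 2)" by (simp add: powr_realpow)
      then show ?thesis by (simp only: powr_add powr_minus) (simp add: field_simps)
    qed
    then have "c * 2 powr (real J / 2) * (2 * real N / 2 ^ J) = c * (2 * real N) * 2 powr - (real J / 2)"
      by (simp add: field_simps)
    also have "\<dots> \<le> c * (2 * real N + 1) * 2 powr - (real J / 2)"
      using c by (intro mult_right_mono mult_left_mono) auto
    finally show "(LINT x|lborel. \<bar>cdv_scaling N \<phi> J k x\<bar>) \<le> c * (2 * real N + 1) * 2 powr - (real J / 2)" .
  qed
qed

end

lemma daubechies_pair_orthonormal_shifts:
  assumes "daubechies_pair N \<phi> \<psi>" "continuous_on UNIV \<phi>"
  shows "orthonormal_shifts N \<phi>"
proof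
  have supp: "closure {x. \<phi> x \<noteq> 0} = {1 - real N..real N}"
    and one: "(LINT x|lborel. \<phi> x) = 1"
    and orth: "(LINT x|lborel. \<phi> x * \<phi> (x - of_int m)) = (if m = 0 then 1 else 0)" for m
    using assms(1) by (simp_all add: daubechies_pair_def)
  show "continuous_on UNIV \<phi>" by fact
  show in_supp: "1 - real N \<le> x \<and> x \<le> real N" if "\<phi> x \<noteq> 0" for x
    using that supp closure_subset[of "{x. \<phi> x \<noteq> 0}"] by auto
  show "(LINT x|lborel. \<phi> x * \<phi> (x - of_int m)) = (if m = 0 then 1 else 0)" for m by (rule orth)
  have "N \<noteq> 0"
  proof
    assume "N = 0"
    then have "\<phi> = (\<lambda>x. 0)" using in_supp by fastforce
    then show False using one by simp
  qed
  then have N: "1 - real N < real N" by simp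
  \<comment> \<open>By continuity \<open>\<phi>\<close> vanishes at the end points of its support as well, so the points at which it is
    nonzero near an end point lie strictly inside.\<close>
  have out: "closed {x. \<phi> x = 0}"
    using assms(2) by (intro closed_Collect_eq) auto
  have "closure {real N<..} \<subseteq> {x. \<phi> x = 0}" using in_supp by (intro closure_minimal out) force
  then have right: "\<phi> (real N) = 0" by auto
  have "closure {..<1 - real N} \<subseteq> {x. \<phi> x = 0}" using in_supp by (intro closure_minimal out) force
  then have left: "\<phi> (1 - real N) = 0" by auto
  have "real N \<in> closure {x. \<phi> x \<noteq> 0}" "1 - real N \<in> closure {x. \<phi> x \<noteq> 0}"
    unfolding supp using N by auto
  then obtain x y where "\<phi> x \<noteq> 0" "dist x (real N) < 1" "\<phi> y \<noteq> 0" "dist y (1 - real N) < 1"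
    unfolding closure_approachable by (metis (mono_tags, lifting) mem_Collect_eq zero_less_one)
  moreover have "x \<noteq> real N" "y \<noteq> 1 - real N" using right left calculation by auto
  ultimately have "real N - 1 < x \<and> x < real N \<and> \<phi> x \<noteq> 0" "1 - real N < y \<and> y < 2 - real N \<and> \<phi> y \<noteq> 0"
    using in_supp[of x] in_supp[of y] by (auto simp: dist_real_def abs_less_iff)
  then show "\<exists>x. real N - 1 < x \<and> x < real N \<and> \<phi> x \<noteq> 0" "\<exists>x. 1 - real N < x \<and> x < 2 - real N \<and> \<phi> x \<noteq> 0"
    by blast+
qed

section \<open>Tensor products and densities\<close>

lemma
  fixes f :: "'d::finite \<Rightarrow> real \<Rightarrow> real"
  assumes int: "\<And>l. integrable lborel (f l)"
  shows integral_lborel_vec_prod: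
      "(LINT x|(lborel :: (real ^ 'd) measure). (\<Prod>l\<in>UNIV. f l (x $ l))) = (\<Prod>l\<in>UNIV. (LINT t|lborel. f l t))"
    and integrable_lborel_vec_prod:
      "integrable (lborel :: (real ^ 'd) measure) (\<lambda>x. \<Prod>l\<in>UNIV. f l (x $ l))"
proof -
  interpret product_sigma_finite "\<lambda>_ :: real ^ 'd. lborel :: real measure" ..
  define ax where "ax l = (axis l 1 :: real ^ 'd)" for l
  have inj: "inj ax" by (auto simp: inj_def ax_def axis_eq_axis)
  have Basis: "(Basis :: (real ^ 'd) set) = range ax" by (auto simp: Basis_vec_def ax_def)
  define g where "g b = f (inv ax b)" for b
  have g: "integrable lborel (g b)" for b by (simp add: g_def int)
  have [measurable]: "f l \<in> borel_measurable borel" for l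
    using borel_measurable_integrable[OF int[of l]] by simp
  have eq: "(\<Prod>l\<in>UNIV. f l (x $ l)) = (\<Prod>b\<in>Basis. g b (x \<bullet> b))" for x
    using inj by (simp add: Basis prod.reindex g_def ax_def[symmetric] cart_eq_inner_axis)
  have point: "(\<Prod>b\<in>Basis. g b ((\<Sum>b\<in>Basis. w b *\<^sub>R b) \<bullet> b)) = (\<Prod>b\<in>Basis. g b (w b))"
    for w :: "real ^ 'd \<Rightarrow> real"
    by (intro prod.cong refl) simp
  have meas: "(\<lambda>x :: real ^ 'd. \<Prod>b\<in>Basis. g b (x \<bullet> b)) \<in> borel_measurable borel"
    unfolding g_def by measurable
  have T: "(\<lambda>w. \<Sum>b\<in>(Basis :: (real ^ 'd) set). w b *\<^sub>R b) \<in> (\<Pi>\<^sub>M b\<in>Basis. lborel) \<rightarrow>\<^sub>M borel"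
    by measurable
  have "(LINT x|(lborel :: (real ^ 'd) measure). (\<Prod>b\<in>Basis. g b (x \<bullet> b)))
      = (LINT w|(\<Pi>\<^sub>M b\<in>(Basis :: (real ^ 'd) set). lborel). (\<Prod>b\<in>Basis. g b (w b)))"
    by (subst lborel_eq, subst integral_distr[OF T meas]) (simp add: point)
  also have "\<dots> = (\<Prod>b\<in>(Basis :: (real ^ 'd) set). (LINT t|lborel. g b t))"
    by (rule product_integral_prod) (auto intro: g)
  also have "\<dots> = (\<Prod>l\<in>UNIV. (LINT t|lborel. f l t))"
    using inj by (simp add: Basis prod.reindex g_def)
  finally show "(LINT x|(lborel :: (real ^ 'd) measure). (\<Prod>l\<in>UNIV. f l (x $ l))) = (\<Prod>l\<in>UNIV. (LINT t|lborel. f l t))"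
    by (simp add: eq)
  have "integrable (\<Pi>\<^sub>M b\<in>(Basis :: (real ^ 'd) set). lborel) (\<lambda>w. \<Prod>b\<in>Basis. g b (w b))"
    by (rule product_integrable_prod) (auto intro: g)
  then show "integrable (lborel :: (real ^ 'd) measure) (\<lambda>x. \<Prod>l\<in>UNIV. f l (x $ l))"
    unfolding eq by (subst lborel_eq, subst integrable_distr_eq[OF T meas]) (simp add: point)
qed

text \<open>A density bounded from above and below on \<open>Q\<close> makes expectations comparable to integrals, for
  nonnegative functions that vanish outside \<open>Q\<close>.  The lower bound gives coercivity of the Gram
  matrix, the upper one the bounds on its entries and on the moments.\<close>

lemma
  fixes g :: "'a \<Rightarrow> real" and f :: "'a \<Rightarrow> ennreal"
  assumes X: "distributed M N X f"
    and bounds: "\<And>x. x \<in> Q \<Longrightarrow> ennreal lo \<le> f x \<and> f x \<le> ennreal hi" "0 \<le> lo" "0 \<le> hi"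
    and g: "integrable N g" "\<And>x. x \<notin> Q \<Longrightarrow> g x = 0" "\<And>x. 0 \<le> g x"
  shows integrable_density_bounds: "integrable M (\<lambda>\<omega>. g (X \<omega>))"
    and integral_ge_density_bound: "lo * (LINT x|N. g x) \<le> (LINT \<omega>|M. g (X \<omega>))"
    and integral_le_density_bound: "(LINT \<omega>|M. g (X \<omega>)) \<le> hi * (LINT x|N. g x)"
proof -
  have [measurable]: "X \<in> M \<rightarrow>\<^sub>M N" "g \<in> borel_measurable N" "f \<in> borel_measurable N"
    using X g(1) by (auto simp: distributed_def)
  have nn: "(\<integral>\<^sup>+\<omega>. ennreal (g (X \<omega>)) \<partial>M) = (\<integral>\<^sup>+x. f x * ennreal (g x) \<partial>N)"
    by (rule distributed_nn_integral[OF X, symmetric]) measurable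
  have scaled: "(\<integral>\<^sup>+x. ennreal c * ennreal (g x) \<partial>N) = ennreal (c * (LINT x|N. g x))" if "0 \<le> c" for c
    using that g by (simp add: nn_integral_cmult nn_integral_eq_integral ennreal_mult)
  have "f x * ennreal (g x) \<le> ennreal hi * ennreal (g x)" "ennreal lo * ennreal (g x) \<le> f x * ennreal (g x)" for x
    using bounds(1)[of x] g(2)[of x] by (cases "x \<in> Q"; auto intro!: mult_right_mono)+
  then have le: "(\<integral>\<^sup>+\<omega>. ennreal (g (X \<omega>)) \<partial>M) \<le> ennreal (hi * (LINT x|N. g x))"
    and ge: "ennreal (lo * (LINT x|N. g x)) \<le> (\<integral>\<^sup>+\<omega>. ennreal (g (X \<omega>)) \<partial>M)"
    unfolding nn scaled[OF bounds(2), symmetric] scaled[OF bounds(3), symmetric]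
    by (auto intro!: nn_integral_mono)
  show int: "integrable M (\<lambda>\<omega>. g (X \<omega>))"
    using le g(3) by (intro integrableI_nonneg) (auto simp: order.strict_trans1[OF _ ennreal_less_top])
  have *: "(\<integral>\<^sup>+\<omega>. ennreal (g (X \<omega>)) \<partial>M) = ennreal (LINT \<omega>|M. g (X \<omega>))"
    using int g(3) by (intro nn_integral_eq_integral) auto
  have pos: "0 \<le> (LINT x|N. g x)" "0 \<le> (LINT \<omega>|M. g (X \<omega>))"
    using g(3) by (auto intro!: Bochner_Integration.integral_nonneg)
  show "lo * (LINT x|N. g x) \<le> (LINT \<omega>|M. g (X \<omega>))"
    using ge pos unfolding * by (simp add: ennreal_le_iff)
  show "(LINT \<omega>|M. g (X \<omega>)) \<le> hi * (LINT x|N. g x)"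
    using le pos bounds(3) unfolding * by (simp add: ennreal_le_iff)
qed

lemma integral_double_sum:
  fixes F :: "'k \<Rightarrow> 'k \<Rightarrow> 'a \<Rightarrow> real"
  assumes "\<And>i j. \<lbrakk>i \<in> I; j \<in> I\<rbrakk> \<Longrightarrow> integrable M (F i j)"
  shows "(LINT x|M. (\<Sum>i\<in>I. \<Sum>j\<in>I. c i j * F i j x)) = (\<Sum>i\<in>I. \<Sum>j\<in>I. c i j * (LINT x|M. F i j x))"
proof -
  have "(LINT x|M. (\<Sum>i\<in>I. \<Sum>j\<in>I. c i j * F i j x)) = (\<Sum>i\<in>I. LINT x|M. (\<Sum>j\<in>I. c i j * F i j x))"
    using assms
    by (intro Bochner_Integration.integral_sum Bochner_Integration.integrable_sum integrable_mult_right) auto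
  also have "\<dots> = (\<Sum>i\<in>I. \<Sum>j\<in>I. LINT x|M. c i j * F i j x)"
    using assms
    by (intro sum.cong refl Bochner_Integration.integral_sum integrable_mult_right) auto
  finally show ?thesis by simp
qed

lemma wav_tensor_eq_0:
  assumes "x \<notin> cbox 0 1"
  shows "wav_tensor N \<phi> J k x = 0"
proof -
  obtain l where "x $ l \<notin> {0..1}" using assms by (auto simp: mem_box_cart)
  then have "cdv_scaling N \<phi> J (k l) (x $ l) = 0" by (simp only: cdv_scaling_def if_False)
  then show ?thesis unfolding wav_tensor_def by (intro prod_zero) auto
qed

lemma finite_wav_index: "finite (wav_index J :: ('d::finite \<Rightarrow> nat) set)"
proof -
  have "(wav_index J :: ('d \<Rightarrow> nat) set) = PiE UNIV (\<lambda>_. {..<2 ^ J})" by (auto simp: wav_index_def)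
  then show ?thesis by (simp add: finite_PiE)
qed

context orthonormal_shifts
begin

lemma
  fixes i j :: "'d::finite \<Rightarrow> nat"
  assumes J: "4 * N \<le> 2 ^ J" and ij: "i \<in> wav_index J" "j \<in> wav_index J"
  shows wav_tensor_orthonormal:
      "(LINT x|lborel. wav_tensor N \<phi> J i x * wav_tensor N \<phi> J j x) = (if i = j then 1 else 0)"
    and integrable_wav_tensor_mult: "integrable lborel (\<lambda>x. wav_tensor N \<phi> J i x * wav_tensor N \<phi> J j x)"
proof -
  have lt: "i l < 2 ^ J" "j l < 2 ^ J" for l using ij by (auto simp: wav_index_def)
  have J': "2 * N \<le> 2 ^ J" using J by linarith
  have eq: "wav_tensor N \<phi> J i x * wav_tensor N \<phi> J j x
      = (\<Prod>l\<in>UNIV. cdv_scaling N \<phi> J (i l) (x $ l) * cdv_scaling N \<phi> J (j l) (x $ l))" for x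
    by (simp add: wav_tensor_def prod.distrib)
  have int: "integrable lborel (\<lambda>t. cdv_scaling N \<phi> J (i l) t * cdv_scaling N \<phi> J (j l) t)" for l
    by (intro bounded_compact_integrable bounded_compact_mult bounded_compact_cdv_scaling J' lt)
  show "integrable lborel (\<lambda>x. wav_tensor N \<phi> J i x * wav_tensor N \<phi> J j x)"
    unfolding eq by (rule integrable_lborel_vec_prod[OF int])
  have "(LINT x|lborel. wav_tensor N \<phi> J i x * wav_tensor N \<phi> J j x) = (\<Prod>l\<in>UNIV. if i l = j l then 1 else 0)"
    unfolding eq integral_lborel_vec_prod[OF int] by (simp add: cdv_scaling_orthonormal[OF J lt])
  also have "\<dots> = (if i = j then 1 else 0)"
  proof (cases "i = j")
    case False
    then obtain l where "i l \<noteq> j l" by blast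
    then show ?thesis using False by (auto intro!: prod_zero bexI[of _ l])
  qed simp
  finally show "(LINT x|lborel. wav_tensor N \<phi> J i x * wav_tensor N \<phi> J j x) = (if i = j then 1 else 0)" .
qed

lemma integrable_wav_tensor:
  fixes k :: "'d::finite \<Rightarrow> nat"
  assumes "2 * N \<le> 2 ^ J" "k \<in> wav_index J"
  shows "integrable lborel (wav_tensor N \<phi> J k)"
  unfolding wav_tensor_def[abs_def] using assms
  by (intro integrable_lborel_vec_prod bounded_compact_integrable bounded_compact_cdv_scaling)
    (auto simp: wav_index_def)

lemma wav_tensor_band:
  fixes i j :: "'d::finite \<Rightarrow> nat"
  assumes "2 * N \<le> 2 ^ J" "i \<in> wav_index J" "j \<in> wav_index J" "int (2 * N) < \<bar>int (i l) - int (j l)\<bar>"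
  shows "wav_tensor N \<phi> J i x * wav_tensor N \<phi> J j x = 0"
proof (rule ccontr)
  assume "wav_tensor N \<phi> J i x * wav_tensor N \<phi> J j x \<noteq> 0"
  then have nz: "cdv_scaling N \<phi> J (i l) (x $ l) \<noteq> 0" "cdv_scaling N \<phi> J (j l) (x $ l) \<noteq> 0"
    by (auto simp: wav_tensor_def)
  have lt: "i l < 2 ^ J" "j l < 2 ^ J" using assms by (auto simp: wav_index_def)
  have "\<bar>2 ^ J * x $ l - real (i l)\<bar> \<le> real N" "\<bar>2 ^ J * x $ l - real (j l)\<bar> \<le> real N"
    using cdv_scaling_support assms(1) lt nz by blast+
  moreover have "2 * real N < \<bar>real (i l) - real (j l)\<bar>"
    using assms(4) by linarith
  ultimately show False by linarith
qed

lemma wav_tensor_quadratic_form: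
  fixes v :: "('d::finite \<Rightarrow> nat) \<Rightarrow> real"
  assumes "4 * N \<le> 2 ^ J"
  shows "integrable lborel (\<lambda>x. (\<Sum>i\<in>wav_index J. v i * wav_tensor N \<phi> J i x)\<^sup>2)"
    and "(LINT x|lborel. (\<Sum>i\<in>wav_index J. v i * wav_tensor N \<phi> J i x)\<^sup>2) = (\<Sum>i\<in>wav_index J. (v i)\<^sup>2)"
proof -
  have eq: "(\<Sum>i\<in>wav_index J. v i * wav_tensor N \<phi> J i x)\<^sup>2
      = (\<Sum>i\<in>wav_index J. \<Sum>j\<in>wav_index J. v i * v j * (wav_tensor N \<phi> J i x * wav_tensor N \<phi> J j x))" for x
    unfolding power2_eq_square sum_product by (intro sum.cong refl) (simp add: mult_ac)
  show "integrable lborel (\<lambda>x. (\<Sum>i\<in>wav_index J. v i * wav_tensor N \<phi> J i x)\<^sup>2)"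
    unfolding eq using integrable_wav_tensor_mult[OF assms]
    by (intro Bochner_Integration.integrable_sum integrable_mult_right) auto
  have "(LINT x|lborel. (\<Sum>i\<in>wav_index J. v i * wav_tensor N \<phi> J i x)\<^sup>2)
      = (\<Sum>i\<in>wav_index J. \<Sum>j\<in>wav_index J. v i * v j * (LINT x|lborel. wav_tensor N \<phi> J i x * wav_tensor N \<phi> J j x))"
    unfolding eq by (rule integral_double_sum) (rule integrable_wav_tensor_mult[OF assms])
  also have "\<dots> = (\<Sum>i\<in>wav_index J. \<Sum>j\<in>wav_index J. if j = i then (v i)\<^sup>2 else 0)"
    by (intro sum.cong refl) (simp add: wav_tensor_orthonormal[OF assms] power2_eq_square)
  also have "\<dots> = (\<Sum>i\<in>wav_index J. (v i)\<^sup>2)"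
    by (simp add: finite_wav_index)
  finally show "(LINT x|lborel. (\<Sum>i\<in>wav_index J. v i * wav_tensor N \<phi> J i x)\<^sup>2) = (\<Sum>i\<in>wav_index J. (v i)\<^sup>2)" .
qed

lemma wav_tensor_bounds:
  obtains C where "0 \<le> C"
    and "\<And>J (x :: real ^ 'd::finite). 2 * N \<le> 2 ^ J
      \<Longrightarrow> (\<Sum>k\<in>wav_index J. \<bar>wav_tensor N \<phi> J k x\<bar>) \<le> C * (2 powr (real J / 2)) ^ CARD('d)"
    and "\<And>J (k :: 'd \<Rightarrow> nat). \<lbrakk>2 * N \<le> 2 ^ J; k \<in> wav_index J\<rbrakk>
      \<Longrightarrow> (LINT x|lborel. \<bar>wav_tensor N \<phi> J k x\<bar>) \<le> C * (2 powr - (real J / 2)) ^ CARD('d)"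
proof -
  obtain c where c: "0 \<le> c"
    and cs: "\<And>J x. 2 * N \<le> 2 ^ J \<Longrightarrow> (\<Sum>k<2 ^ J. \<bar>cdv_scaling N \<phi> J k x\<bar>) \<le> c * 2 powr (real J / 2)"
    and ci: "\<And>J k. \<lbrakk>2 * N \<le> 2 ^ J; k < 2 ^ J\<rbrakk>
      \<Longrightarrow> (LINT x|lborel. \<bar>cdv_scaling N \<phi> J k x\<bar>) \<le> c * 2 powr - (real J / 2)"
    by (rule cdv_scaling_bounds) blast
  show thesis
  proof (rule that[of "c ^ CARD('d)"])
    show "0 \<le> c ^ CARD('d)" using c by simp
  next
    fix J :: nat and x :: "real ^ 'd" assume J: "2 * N \<le> 2 ^ J"
    have "(\<Sum>k\<in>wav_index J. \<bar>wav_tensor N \<phi> J k x\<bar>) = (\<Prod>l\<in>UNIV. \<Sum>t<2 ^ J. \<bar>cdv_scaling N \<phi> J t (x $ l)\<bar>)"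
      unfolding wav_index_def wav_tensor_def abs_prod
      by (rule sum_grid_product[where g = "\<lambda>l t. \<bar>cdv_scaling N \<phi> J t (x $ l)\<bar>" and n = "2 ^ J"])
    also have "\<dots> \<le> (\<Prod>l\<in>(UNIV :: 'd set). c * 2 powr (real J / 2))"
      using cs[OF J] by (intro prod_mono conjI sum_nonneg) auto
    finally show "(\<Sum>k\<in>wav_index J. \<bar>wav_tensor N \<phi> J k x\<bar>) \<le> c ^ CARD('d) * (2 powr (real J / 2)) ^ CARD('d)"
      by (simp add: power_mult_distrib)
  next
    fix J :: nat and k :: "'d \<Rightarrow> nat" assume J: "2 * N \<le> 2 ^ J" and k: "k \<in> wav_index J"
    have lt: "k l < 2 ^ J" for l using k by (simp add: wav_index_def)
    have int: "integrable lborel (\<lambda>t. \<bar>cdv_scaling N \<phi> J (k l) t\<bar>)" for l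
      using bounded_compact_integrable[OF bounded_compact_cdv_scaling[OF J lt]] by simp
    have "(LINT x|lborel. \<bar>wav_tensor N \<phi> J k x\<bar>) = (\<Prod>l\<in>UNIV. (LINT t|lborel. \<bar>cdv_scaling N \<phi> J (k l) t\<bar>))"
      unfolding wav_tensor_def abs_prod by (rule integral_lborel_vec_prod[OF int])
    also have "\<dots> \<le> (\<Prod>l\<in>(UNIV :: 'd set). c * 2 powr - (real J / 2))"
      using ci[OF J lt] by (intro prod_mono conjI Bochner_Integration.integral_nonneg) auto
    finally show "(LINT x|lborel. \<bar>wav_tensor N \<phi> J k x\<bar>) \<le> c ^ CARD('d) * (2 powr - (real J / 2)) ^ CARD('d)"
      by (simp add: power_mult_distrib)
  qed
qed

section \<open>The projection\<close>

text \<open>The coefficient vector \<open>a\<close> of the projection solves the normal equations \<open>G a = y\<close> with the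
  Gram matrix \<open>G\<close> and the moments \<open>y\<close>.  Orthonormality in Lebesgue measure and the bounds on the
  density make \<open>G\<close> coercive, with constants that do not depend on \<open>J\<close>, and the supports make it
  banded, so that \<open>a\<close> is bounded by a constant times the largest moment.  The moments have the order
  of \<open>2 ^ (- d J / 2)\<close>, and the sum of the absolute values of the basis functions at a point has the
  order of \<open>2 ^ (d J / 2)\<close>.\<close>

lemma series_proj_bounded:
  fixes X :: "'w \<Rightarrow> real ^ 'd" and f :: "real ^ 'd \<Rightarrow> ennreal"
  assumes X: "distributed M lborel X f" "\<And>\<omega>. \<omega> \<in> space M \<Longrightarrow> X \<omega> \<in> S"
    and bounds: "\<And>x. x \<in> cbox 0 1 \<Longrightarrow> ennreal lo \<le> f x \<and> f x \<le> ennreal hi" "0 < lo" "0 \<le> hi"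
  obtains C where "0 \<le> C"
    and "\<And>J h H x. \<lbrakk>4 * N \<le> 2 ^ J; (\<lambda>\<omega>. h (X \<omega>)) \<in> borel_measurable M;
        \<And>y. y \<in> S \<Longrightarrow> \<bar>h y\<bar> \<le> H; 0 \<le> H\<rbrakk>
      \<Longrightarrow> \<bar>series_proj M X (wav_index J) (wav_tensor N \<phi> J) h x\<bar> \<le> C * H"
proof -
  obtain D where D: "0 \<le> D"
    and D_solve: "\<And>I (A :: ('d \<Rightarrow> nat) \<Rightarrow> ('d \<Rightarrow> nat) \<Rightarrow> real) a Y i.
      \<lbrakk>finite I; \<And>i j. \<lbrakk>i \<in> I; j \<in> I\<rbrakk> \<Longrightarrow> \<bar>A i j\<bar> \<le> hi;
       \<And>i j l. \<lbrakk>i \<in> I; j \<in> I; int (2 * N) < \<bar>int (i l) - int (j l)\<bar>\<rbrakk> \<Longrightarrow> A i j = 0;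
       \<And>v. lo * (\<Sum>i\<in>I. (v i)\<^sup>2) \<le> (\<Sum>i\<in>I. \<Sum>j\<in>I. v i * A i j * v j);
       \<And>i. i \<in> I \<Longrightarrow> \<bar>\<Sum>j\<in>I. A i j * a j\<bar> \<le> Y; 0 \<le> Y; i \<in> I\<rbrakk>
      \<Longrightarrow> \<bar>a i\<bar> \<le> D * Y"
    by (rule banded_coercive_sup_bound[OF bounds(2,3), where m = "2 * N"]) blast
  obtain c where c: "0 \<le> c"
    and c_sum: "\<And>J (x :: real ^ 'd). 2 * N \<le> 2 ^ J
      \<Longrightarrow> (\<Sum>k\<in>wav_index J. \<bar>wav_tensor N \<phi> J k x\<bar>) \<le> c * (2 powr (real J / 2)) ^ CARD('d)"
    and c_int: "\<And>J (k :: 'd \<Rightarrow> nat). \<lbrakk>2 * N \<le> 2 ^ J; k \<in> wav_index J\<rbrakk>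
      \<Longrightarrow> (LINT x|lborel. \<bar>wav_tensor N \<phi> J k x\<bar>) \<le> c * (2 powr - (real J / 2)) ^ CARD('d)"
    by (rule wav_tensor_bounds) blast
  have lo: "0 \<le> lo" using bounds(2) by simp
  have density: "integrable M (\<lambda>\<omega>. g (X \<omega>))"
      "lo * (LINT x|lborel. g x) \<le> (LINT \<omega>|M. g (X \<omega>))"
      "(LINT \<omega>|M. g (X \<omega>)) \<le> hi * (LINT x|lborel. g x)"
    if "integrable lborel g" "\<And>x. x \<notin> cbox 0 1 \<Longrightarrow> g x = 0" "\<And>x. 0 \<le> g x" for g
    using integrable_density_bounds[where Q = "cbox 0 1", OF X(1) _ lo bounds(3) that]
      integral_ge_density_bound[where Q = "cbox 0 1", OF X(1) _ lo bounds(3) that]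
      integral_le_density_bound[where Q = "cbox 0 1", OF X(1) _ lo bounds(3) that] bounds(1)
    by blast+
  show thesis
  proof (rule that[of "c * D * hi * c"])
    show "0 \<le> c * D * hi * c" using c D bounds(3) by simp
  next
    fix J :: nat and h :: "real ^ 'd \<Rightarrow> real" and H :: real and x :: "real ^ 'd"
    assume J: "4 * N \<le> 2 ^ J" and h[measurable]: "(\<lambda>\<omega>. h (X \<omega>)) \<in> borel_measurable M"
      and H: "\<And>y. y \<in> S \<Longrightarrow> \<bar>h y\<bar> \<le> H" "0 \<le> H"
    have J': "2 * N \<le> 2 ^ J" using J by linarith
    define I where "I = (wav_index J :: ('d \<Rightarrow> nat) set)"
    define b where "b = (wav_tensor N \<phi> J :: ('d \<Rightarrow> nat) \<Rightarrow> real ^ 'd \<Rightarrow> real)"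
    define G where "G = gram M X b"
    have fin: "finite I" by (simp add: I_def finite_wav_index)
    have b_out: "b i x = 0" if "x \<notin> cbox 0 1" for i x using wav_tensor_eq_0[OF that] by (simp add: b_def)
    have X_meas[measurable]: "X \<in> M \<rightarrow>\<^sub>M lborel" using X(1) by (simp add: distributed_def)
    have b_int: "integrable lborel (b i)" if "i \<in> I" for i
      using integrable_wav_tensor[OF J'] that by (simp add: b_def I_def)
    have bX_meas: "(\<lambda>\<omega>. b i (X \<omega>)) \<in> borel_measurable M" if "i \<in> I" for i
      by (rule measurable_compose[OF X_meas borel_measurable_integrable[OF b_int[OF that]]])
    have bb_int: "integrable lborel (\<lambda>x. b i x * b j x)" if "i \<in> I" "j \<in> I" for i j
      using integrable_wav_tensor_mult[OF J] that by (simp add: b_def I_def)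
    have abs_bb_int: "integrable lborel (\<lambda>x. \<bar>b i x * b j x\<bar>)" if "i \<in> I" "j \<in> I" for i j
      using bb_int[OF that] by (rule integrable_abs)
    have abs_bb_X: "integrable M (\<lambda>\<omega>. \<bar>b i (X \<omega>) * b j (X \<omega>)\<bar>)" if "i \<in> I" "j \<in> I" for i j
      by (rule density(1)[of "\<lambda>x. \<bar>b i x * b j x\<bar>", OF abs_bb_int[OF that]]) (auto simp: b_out)
    have bb_X: "integrable M (\<lambda>\<omega>. b i (X \<omega>) * b j (X \<omega>))" if "i \<in> I" "j \<in> I" for i j
      using abs_bb_X[OF that] bX_meas[OF that(1)] bX_meas[OF that(2)]
      by (subst (asm) integrable_abs_iff) auto
    have G_sym: "G i j = G j i" for i j by (simp add: G_def gram_def mult.commute)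
    have G_bound: "\<bar>G i j\<bar> \<le> hi" if "i \<in> I" "j \<in> I" for i j
    proof -
      have "\<bar>G i j\<bar> \<le> (LINT \<omega>|M. \<bar>b i (X \<omega>) * b j (X \<omega>)\<bar>)"
        unfolding G_def gram_def by (rule integral_abs_bound)
      also have "\<dots> \<le> hi * (LINT x|lborel. \<bar>b i x * b j x\<bar>)"
        by (rule density(3)[of "\<lambda>x. \<bar>b i x * b j x\<bar>", OF abs_bb_int[OF that]]) (auto simp: b_out)
      also have "(LINT x|lborel. \<bar>b i x * b j x\<bar>) \<le> (LINT x|lborel. (b i x * b i x + b j x * b j x) / 2)"
      proof (rule integral_mono)
        show "\<bar>b i x * b j x\<bar> \<le> (b i x * b i x + b j x * b j x) / 2" for x
          using sum_squares_bound[of "\<bar>b i x\<bar>" "\<bar>b j x\<bar>"] by (simp add: abs_mult power2_eq_square)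
      qed (use that abs_bb_int bb_int in auto)
      also have "\<dots> = 1"
        using that bb_int[OF that(1,1)] bb_int[OF that(2,2)]
          wav_tensor_orthonormal[OF J, of i i] wav_tensor_orthonormal[OF J, of j j]
        by (simp add: b_def I_def)
      finally show ?thesis using bounds(3) by (simp add: mult_left_mono)
    qed
    have G_band: "G i j = 0" if "i \<in> I" "j \<in> I" "int (2 * N) < \<bar>int (i l) - int (j l)\<bar>" for i j l
    proof -
      have "b i x * b j x = 0" for x
        using wav_tensor_band[OF J', of i j l x] that unfolding b_def I_def by blast
      then show ?thesis by (simp only: G_def gram_def) simp
    qed
    have G_coercive: "lo * (\<Sum>i\<in>I. (v i)\<^sup>2) \<le> (\<Sum>i\<in>I. \<Sum>j\<in>I. v i * G i j * v j)" for v
    proof -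
      have "lo * (\<Sum>i\<in>I. (v i)\<^sup>2) = lo * (LINT x|lborel. (\<Sum>i\<in>I. v i * b i x)\<^sup>2)"
        unfolding I_def b_def wav_tensor_quadratic_form(2)[OF J] ..
      also have "\<dots> \<le> (LINT \<omega>|M. ((\<Sum>i\<in>I. v i * b i (X \<omega>))\<^sup>2))"
        using wav_tensor_quadratic_form(1)[OF J, of v] unfolding I_def[symmetric] b_def[symmetric]
        by (intro density(2)[of "\<lambda>x. (\<Sum>i\<in>I. v i * b i x)\<^sup>2"]) (auto simp: b_out)
      also have "\<dots> = (LINT \<omega>|M. (\<Sum>i\<in>I. \<Sum>j\<in>I. v i * v j * (b i (X \<omega>) * b j (X \<omega>))))"
        unfolding power2_eq_square sum_product
        by (intro Bochner_Integration.integral_cong sum.cong refl) (simp add: mult_ac)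
      also have "\<dots> = (\<Sum>i\<in>I. \<Sum>j\<in>I. v i * v j * G i j)"
        unfolding G_def gram_def by (rule integral_double_sum) (rule bb_X)
      also have "\<dots> = (\<Sum>i\<in>I. \<Sum>j\<in>I. v i * G i j * v j)" by (simp add: mult_ac)
      finally show ?thesis .
    qed
    have G_pos: "0 < (\<Sum>i\<in>I. \<Sum>j\<in>I. v i * G i j * v j)" if "\<exists>i\<in>I. v i \<noteq> 0" for v
    proof -
      have "0 < (\<Sum>i\<in>I. (v i)\<^sup>2)" using that fin by (auto intro!: sum_pos2)
      then show ?thesis using G_coercive[of v] bounds(2) by (meson mult_pos_pos less_le_trans)
    qed
    define y where "y j = (LINT \<omega>|M. b j (X \<omega>) * h (X \<omega>))" for j
    define Y where "Y = H * (hi * (c * (2 powr - (real J / 2)) ^ CARD('d)))"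
    have Y: "0 \<le> Y" using H(2) bounds(3) c by (simp add: Y_def)
    have y_bound: "\<bar>y j\<bar> \<le> Y" if "j \<in> I" for j
    proof -
      have abs_b: "integrable lborel (\<lambda>x. \<bar>b j x\<bar>)" using b_int[OF that] by simp
      have abs_bX: "integrable M (\<lambda>\<omega>. \<bar>b j (X \<omega>)\<bar>)"
        by (rule density(1)[of "\<lambda>x. \<bar>b j x\<bar>", OF abs_b]) (auto simp: b_out)
      have "\<bar>y j\<bar> \<le> (LINT \<omega>|M. \<bar>b j (X \<omega>) * h (X \<omega>)\<bar>)"
        unfolding y_def by (rule integral_abs_bound)
      also have "\<dots> \<le> (LINT \<omega>|M. H * \<bar>b j (X \<omega>)\<bar>)"
      proof (rule integral_mono')
        show "integrable M (\<lambda>\<omega>. H * \<bar>b j (X \<omega>)\<bar>)" using abs_bX by simp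
        fix \<omega> assume "\<omega> \<in> space M"
        then have "\<bar>h (X \<omega>)\<bar> \<le> H" using H(1) X(2) by blast
        then show "\<bar>b j (X \<omega>) * h (X \<omega>)\<bar> \<le> H * \<bar>b j (X \<omega>)\<bar>"
          by (simp add: abs_mult mult.commute mult_right_mono)
      qed (use H(2) in simp)
      also have "\<dots> = H * (LINT \<omega>|M. \<bar>b j (X \<omega>)\<bar>)" by simp
      also have "\<dots> \<le> H * (hi * (LINT x|lborel. \<bar>b j x\<bar>))"
        using density(3)[of "\<lambda>x. \<bar>b j x\<bar>", OF abs_b] H(2) by (intro mult_left_mono) (auto simp: b_out)
      also have "\<dots> \<le> Y"
        unfolding Y_def using c_int[OF J', of j] that H(2) bounds(3)
        by (intro mult_left_mono) (auto simp: b_def I_def)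
      finally show ?thesis .
    qed
    define a where "a i = (\<Sum>j\<in>I. matrix_inv_on I G i j * y j)" for i
    have "(\<Sum>k\<in>I. G i k * a k) = y i" if "i \<in> I" for i
    proof -
      have "(\<Sum>k\<in>I. G i k * a k) = (\<Sum>j\<in>I. (\<Sum>k\<in>I. G i k * matrix_inv_on I G k j) * y j)"
        unfolding a_def sum_distrib_left sum_distrib_right
        by (subst sum.swap) (simp add: mult.assoc)
      also have "\<dots> = (\<Sum>j\<in>I. if j = i then y i else 0)"
        using matrix_inv_on_right_inverse[OF fin G_sym G_pos that] by (intro sum.cong refl) auto
      also have "\<dots> = y i" using that fin by simp
      finally show ?thesis .
    qed
    then have a_bound: "\<bar>a i\<bar> \<le> D * Y" if "i \<in> I" for i
      using D_solve[of I G a Y i] fin G_bound G_band G_coercive y_bound Y that by simp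
    have "series_proj M X I b h x = (\<Sum>i\<in>I. b i x * a i)"
      unfolding series_proj_def a_def y_def G_def by (simp add: sum_distrib_left mult.assoc)
    then have "\<bar>series_proj M X I b h x\<bar> \<le> (\<Sum>i\<in>I. \<bar>b i x\<bar> * \<bar>a i\<bar>)"
      using sum_abs[of "\<lambda>i. b i x * a i" I] by (simp add: abs_mult)
    also have "\<dots> \<le> (\<Sum>i\<in>I. \<bar>b i x\<bar> * (D * Y))" by (intro sum_mono mult_left_mono a_bound) auto
    also have "\<dots> = (\<Sum>i\<in>I. \<bar>b i x\<bar>) * (D * Y)" by (simp only: sum_distrib_right)
    also have "\<dots> \<le> c * (2 powr (real J / 2)) ^ CARD('d) * (D * Y)"
      using c_sum[OF J', of x] D Y by (intro mult_right_mono) (auto simp: b_def I_def)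
    also have "\<dots> = c * D * hi * c * H * ((2 powr (real J / 2)) ^ CARD('d) * (2 powr - (real J / 2)) ^ CARD('d))"
      by (simp add: Y_def mult_ac)
    also have "(2 powr (real J / 2)) ^ CARD('d) * (2 powr - (real J / 2)) ^ CARD('d) = (1 :: real)"
      by (simp flip: power_mult_distrib powr_add)
    finally show "\<bar>series_proj M X (wav_index J) (wav_tensor N \<phi> J) h x\<bar> \<le> c * D * hi * c * H"
      by (simp add: I_def b_def)
  qed
qed

end

theorem theorem5p1:
  fixes M :: "'w measure"
    and X :: "'w \<Rightarrow> real ^ 'd"
    and S :: "(real ^ 'd) set"
    and f :: "real ^ 'd \<Rightarrow> ennreal"
    and N :: nat
    and \<phi> \<psi> :: "real \<Rightarrow> real"
  assumes "prob_space M"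
    and "\<And>\<omega>. \<omega> \<in> space M \<Longrightarrow> X \<omega> \<in> S"
    and "cbox 0 1 \<subseteq> S"
    and "distributed M lborel X f"
    and "0 < (INF x\<in>cbox 0 1. f x)"
    and "(SUP x\<in>cbox 0 1. f x) < \<infinity>"
    and "daubechies_pair N \<phi> \<psi>"
    and "continuous_on UNIV \<phi>"
  shows "\<exists>C::real. \<forall>\<^sub>F K::nat in sequentially. \<forall>J::nat.
           K = 2 ^ (CARD('d) * J) \<and> 2 ^ J > 2 * N \<longrightarrow>
           proj_norm M X S (wav_index J) (wav_tensor N \<phi> J) \<le> ennreal C"
proof -
  interpret orthonormal_shifts N \<phi>
    by (rule daubechies_pair_orthonormal_shifts) fact+
  define lo where "lo = enn2real (INF x\<in>cbox 0 1. f x)"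
  define hi where "hi = enn2real (SUP x\<in>cbox 0 1. f x)"
  have "(0 :: real ^ 'd) \<in> cbox 0 1" by (simp add: mem_box_cart)
  then have ne: "cbox 0 1 \<noteq> ({} :: (real ^ 'd) set)" by blast
  have hi: "(SUP x\<in>cbox 0 1. f x) = ennreal hi" using assms(6) by (simp add: hi_def)
  have "(INF x\<in>cbox 0 1. f x) \<le> (SUP x\<in>cbox 0 1. f x)" using ne by (intro INF_le_SUP)
  then have "(INF x\<in>cbox 0 1. f x) < \<infinity>" using assms(6) by (rule order.strict_trans1)
  then have lo: "(INF x\<in>cbox 0 1. f x) = ennreal lo" by (simp add: lo_def)
  then have lo_pos: "0 < lo" using assms(5) by simp
  have bounds: "ennreal lo \<le> f x \<and> f x \<le> ennreal hi" if "x \<in> cbox 0 1" for x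
    unfolding lo[symmetric] hi[symmetric] using that by (auto intro: INF_lower SUP_upper)
  obtain C where C: "0 \<le> C"
    and C_bound: "\<And>J h H x. \<lbrakk>4 * N \<le> 2 ^ J; (\<lambda>\<omega>. h (X \<omega>)) \<in> borel_measurable M;
        \<And>y. y \<in> S \<Longrightarrow> \<bar>h y\<bar> \<le> H; 0 \<le> H\<rbrakk>
      \<Longrightarrow> \<bar>series_proj M X (wav_index J) (wav_tensor N \<phi> J) h x\<bar> \<le> C * H"
    by (rule series_proj_bounded[where S = S and lo = lo and hi = hi, OF assms(4)])
      (use assms(2) bounds lo_pos in \<open>auto simp: hi_def\<close>)
  have norm_bound: "proj_norm M X S (wav_index J) (wav_tensor N \<phi> J) \<le> ennreal C" if J: "4 * N \<le> 2 ^ J" for J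
    unfolding proj_norm_def
  proof (rule SUP_least)
    fix h assume "h \<in> {h \<in> bounded_functions M X S. sup_norm S h \<noteq> 0}"
    then have h: "bounded (h ` S)" "(\<lambda>\<omega>. h (X \<omega>)) \<in> borel_measurable M" "sup_norm S h \<noteq> 0"
      by (auto simp: bounded_functions_def)
    obtain c where c: "\<And>x. x \<in> S \<Longrightarrow> \<bar>h x\<bar> \<le> c" using h(1) by (auto simp: bounded_iff)
    define H where "H = enn2real (sup_norm S h)"
    have "sup_norm S h \<le> ennreal c"
      unfolding sup_norm_def using c by (intro SUP_least ennreal_leI)
    then have H: "sup_norm S h = ennreal H"
      by (simp add: H_def order.strict_trans1[OF _ ennreal_less_top])
    have "0 < H" using h(3) unfolding H by (simp add: ennreal_eq_0_iff)
    have "\<bar>h y\<bar> \<le> H" if "y \<in> S" for y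
    proof -
      have "ennreal \<bar>h y\<bar> \<le> sup_norm S h" unfolding sup_norm_def using that by (rule SUP_upper)
      then show ?thesis using \<open>0 < H\<close> unfolding H by (simp add: ennreal_le_iff)
    qed
    then have "\<bar>series_proj M X (wav_index J) (wav_tensor N \<phi> J) h x\<bar> \<le> C * H" for x
      using J h(2) \<open>0 < H\<close> by (intro C_bound) auto
    then have "sup_norm S (series_proj M X (wav_index J) (wav_tensor N \<phi> J) h) \<le> ennreal (C * H)"
      unfolding sup_norm_def by (intro SUP_least ennreal_leI)
    then have "sup_norm S (series_proj M X (wav_index J) (wav_tensor N \<phi> J) h) / sup_norm S h
        \<le> ennreal (C * H) / ennreal H"
      unfolding H by (rule divide_right_mono_ennreal)
    also have "\<dots> = ennreal C" using C \<open>0 < H\<close> by (simp add: divide_ennreal)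
    finally show "sup_norm S (series_proj M X (wav_index J) (wav_tensor N \<phi> J) h) / sup_norm S h \<le> ennreal C" .
  qed
  \<comment> \<open>\<open>J \<ge> 4 * N\<close> already gives \<open>2 ^ J \<ge> 4 * N\<close>, from where on the two edges of the interval are
    separated.\<close>
  show ?thesis
  proof (intro exI[of _ C] eventually_mono[OF eventually_ge_at_top[of "2 ^ (CARD('d) * (4 * N))"]] allI impI)
    fix K J :: nat
    assume K: "2 ^ (CARD('d) * (4 * N)) \<le> K" and "K = 2 ^ (CARD('d) * J) \<and> 2 ^ J > 2 * N"
    then have "CARD('d) * (4 * N) \<le> CARD('d) * J" by simp
    then have "4 * N \<le> J" by simp
    also have "J \<le> 2 ^ J" by (simp add: less_imp_le)
    finally show "proj_norm M X S (wav_index J) (wav_tensor N \<phi> J) \<le> ennreal C" by (rule norm_bound)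
  qed
qed

end
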